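(* Let $n$ be a positive integer, $d=2^n$, and let $\oplus^2_{2^n}:\mathbb{Z}_{2^n}^2\times\mathbb{Z}_{2^n}^2\to\mathbb{Z}_{2^n}^2$ be $(q,r)\oplus^2_{2^n}(s,t)=(q+s \bmod 2^n,\; r+t \bmod 2^n)$. Then the dense network coding protocol described in the context computes $\oplus^2_{2^n}$ perfectly (for every pair of inputs $(q,r),(s,t)$ the receiver outputs $(q,r)\oplus^2_{2^n}(s,t)$ with probability one); in particular $$P_S^{\oplus^2_{2^n}}\big(\mathbf{Q}^E(2^n,2^n)\big)=1 .$$ Moreover, if either sender communicates strictly fewer than $n$ qubits, the success probability is bounded away from $1$: for all non-negative integers $n_1,n_2$ with $\min\{n_1,n_2\}<n$, $$P_S^{\oplus^2_{2^n}}\big(\mathbf{Q}^E(2^{n_1},2^{n_2})\big)<1 .$$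
   Context: All Hilbert spaces are finite-dimensional. For finite alphabets $\mathcal X,\mathcal Y,\mathcal Z$ and positive integers $d_1,d_2$, $\mathbf{Q}^E(d_1,d_2)$ (entanglement-assisted quantum multiaccess networks) is the set of conditional distributions $Q_{Z|XY}$ of the form $Q(z|x,y)=\mathrm{Tr}[\Pi_z\,(\mathcal E^x\otimes\mathcal F^y)(\rho_{AB})]$, where $\rho_{AB}$ is a bipartite quantum state on arbitrary (finite-dimensional) systems $A,B$, each $\mathcal E^x$ is a quantum channel from $A$ to $\mathbb C^{d_1}$, each $\mathcal F^y$ is a quantum channel from $B$ to $\mathbb C^{d_2}$, and $\{\Pi_z\}_{z\in\mathcal Z}$ is a POVM on $\mathbb C^{d_1}\otimes\mathbb C^{d_2}$. For a function $f:\mathcal X\times\mathcal Y\to\mathcal Z$, $P_S^f(Q_{Z|XY})=\frac{1}{|\mathcal X||\mathcal Y|}\sum_{x,y}Q(f(x,y)|x,y)$, and for a set $\mathbf S$ of conditional distributions, $P_S^f(\mathbf S)=\sup_{Q\in\mathbf S}P_S^f(Q)$. Protocol. Let $d=2^n$, $\zeta=e^{2\pi i/d}$, $X=\sum_{q\in\mathbb Z_d}|q+1 \bmod d\rangle\langle q|$, $Z=\sum_{q\in\mathbb Z_d}\zeta^q|q\rangle\langle q|$, $W_{q,r}=X^qZ^r$ for $(q,r)\in\mathbb Z_d^2$ (discrete Weyl operators), $|\Phi\rangle=\frac1{\sqrt d}\sum_{i\in\mathbb Z_d}|i\rangle|i\rangle$, $|\Phi_{q,r}\rangle=(W_{q,r}\otimes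 I)|\Phi\rangle$. The senders share $|\Phi\rangle\in\mathbb C^d\otimes\mathbb C^d$. On input $(q,r)$ Sender 1 applies $W_{q,r}$ to their half; on input $(s,t)$ Sender 2 applies the transpose $W_{s,t}^T$ to their half; both forward their systems noiselessly to the receiver, who measures in the orthonormal basis $\{|\Phi_{x,y}\rangle\}_{(x,y)\in\mathbb Z_d^2}$ and outputs the outcome $(x,y)$. *)

theory Defs
  imports Complex_Main "Jordan_Normal_Form.Schur_Decomposition"
begin

text \<open>Operators on \<open>\<complex>\<^sup>m\<close> are complex \<open>m \<times> m\<close> matrices.  The basis vector \<open>|i\<rangle> \<otimes> |k\<rangle>\<close> of
  \<open>\<complex>\<^sup>a \<otimes> \<complex>\<^sup>b\<close> has index \<open>i * b + k\<close>.\<close>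

definition mat_trace :: "complex mat \<Rightarrow> complex" where
  "mat_trace A = (\<Sum>i<dim_row A. A $$ (i, i))"

text \<open>The order on complex numbers is the one in which \<open>0 \<le> z\<close> says that \<open>z\<close> is real and
  nonnegative, so Hermiticity is implied.\<close>

definition psd :: "nat \<Rightarrow> complex mat \<Rightarrow> bool" where
  "psd m A \<longleftrightarrow> A \<in> carrier_mat m m \<and> (\<forall>v\<in>carrier_vec m. 0 \<le> (A *\<^sub>v v) \<bullet>c v)"

definition density_operator :: "nat \<Rightarrow> complex mat \<Rightarrow> bool" where
  "density_operator m \<rho> \<longleftrightarrow> psd m \<rho> \<and> mat_trace \<rho> = 1"

definition povm :: "'z set \<Rightarrow> nat \<Rightarrow> ('z \<Rightarrow> complex mat) \<Rightarrow> bool" where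
  "povm Zs m P \<longleftrightarrow> (\<forall>z\<in>Zs. psd m (P z)) \<and> mat m m (\<lambda>ij. \<Sum>z\<in>Zs. P z $$ ij) = 1\<^sub>m m"

definition kron :: "complex mat \<Rightarrow> complex mat \<Rightarrow> complex mat" where
  "kron A B = mat (dim_row A * dim_row B) (dim_col A * dim_col B)
     (\<lambda>(i, j). A $$ (i div dim_row B, j div dim_col B) * B $$ (i mod dim_row B, j mod dim_col B))"

definition unit_matrix :: "nat \<Rightarrow> nat \<Rightarrow> nat \<Rightarrow> complex mat" where
  "unit_matrix m k l = mat m m (\<lambda>(i, j). if i = k \<and> j = l then 1 else 0)"

text \<open>The tensor product of linear maps \<open>E\<close> (from \<open>a \<times> a\<close> to \<open>b \<times> b\<close> matrices) and
  \<open>F\<close> (from \<open>a' \<times> a'\<close> to \<open>b' \<times> b'\<close> matrices), by linearity from its values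
  \<open>E(|k\<rangle>\<langle>l|) \<otimes> F(|k'\<rangle>\<langle>l'|)\<close> on the matrix units.\<close>

definition tensor_map ::
  "nat \<Rightarrow> nat \<Rightarrow> nat \<Rightarrow> nat \<Rightarrow> (complex mat \<Rightarrow> complex mat) \<Rightarrow> (complex mat \<Rightarrow> complex mat)
   \<Rightarrow> complex mat \<Rightarrow> complex mat" where
  "tensor_map a b a' b' E F M = mat (b * b') (b * b') (\<lambda>ij.
     \<Sum>k<a. \<Sum>l<a. \<Sum>k'<a'. \<Sum>l'<a'. M $$ (k * a' + k', l * a' + l') *
       kron (E (unit_matrix a k l)) (F (unit_matrix a' k' l')) $$ ij)"

definition linear_map_mat :: "nat \<Rightarrow> nat \<Rightarrow> (complex mat \<Rightarrow> complex mat) \<Rightarrow> bool" where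
  "linear_map_mat a b E \<longleftrightarrow>
     (\<forall>M\<in>carrier_mat a a. E M \<in> carrier_mat b b) \<and>
     (\<forall>M\<in>carrier_mat a a. \<forall>N\<in>carrier_mat a a. E (M + N) = E M + E N) \<and>
     (\<forall>c. \<forall>M\<in>carrier_mat a a. E (c \<cdot>\<^sub>m M) = c \<cdot>\<^sub>m E M)"

definition completely_positive :: "nat \<Rightarrow> nat \<Rightarrow> (complex mat \<Rightarrow> complex mat) \<Rightarrow> bool" where
  "completely_positive a b E \<longleftrightarrow>
     (\<forall>k M. psd (a * k) M \<longrightarrow> psd (b * k) (tensor_map a b k k E (\<lambda>N. N) M))"

definition quantum_channel :: "nat \<Rightarrow> nat \<Rightarrow> (complex mat \<Rightarrow> complex mat) \<Rightarrow> bool" where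
  "quantum_channel a b E \<longleftrightarrow> linear_map_mat a b E \<and> completely_positive a b E \<and>
     (\<forall>M\<in>carrier_mat a a. mat_trace (E M) = mat_trace M)"

definition assisted_strategy ::
  "'x set \<Rightarrow> 'y set \<Rightarrow> 'z set \<Rightarrow> nat \<Rightarrow> nat \<Rightarrow> nat \<Rightarrow> nat \<Rightarrow> complex mat
   \<Rightarrow> ('x \<Rightarrow> complex mat \<Rightarrow> complex mat) \<Rightarrow> ('y \<Rightarrow> complex mat \<Rightarrow> complex mat)
   \<Rightarrow> ('z \<Rightarrow> complex mat) \<Rightarrow> bool" where
  "assisted_strategy Xs Ys Zs d1 d2 a b \<rho> E F P \<longleftrightarrow>
     density_operator (a * b) \<rho> \<and>
     (\<forall>x\<in>Xs. quantum_channel a d1 (E x)) \<and>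
     (\<forall>y\<in>Ys. quantum_channel b d2 (F y)) \<and>
     povm Zs (d1 * d2) P"

definition outcome_prob ::
  "nat \<Rightarrow> nat \<Rightarrow> nat \<Rightarrow> nat \<Rightarrow> complex mat
   \<Rightarrow> ('x \<Rightarrow> complex mat \<Rightarrow> complex mat) \<Rightarrow> ('y \<Rightarrow> complex mat \<Rightarrow> complex mat)
   \<Rightarrow> ('z \<Rightarrow> complex mat) \<Rightarrow> 'z \<Rightarrow> 'x \<Rightarrow> 'y \<Rightarrow> complex" where
  "outcome_prob d1 d2 a b \<rho> E F P z x y =
     mat_trace (P z * tensor_map a d1 b d2 (E x) (F y) \<rho>)"

text \<open>\<open>Q z x y\<close> stands for \<open>Q(z|x,y)\<close>; values outside the alphabets are irrelevant and left
  unconstrained.\<close>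

definition QE ::
  "'x set \<Rightarrow> 'y set \<Rightarrow> 'z set \<Rightarrow> nat \<Rightarrow> nat \<Rightarrow> ('z \<Rightarrow> 'x \<Rightarrow> 'y \<Rightarrow> real) set" where
  "QE Xs Ys Zs d1 d2 = {Q. \<exists>a b \<rho> E F P. assisted_strategy Xs Ys Zs d1 d2 a b \<rho> E F P \<and>
     (\<forall>z\<in>Zs. \<forall>x\<in>Xs. \<forall>y\<in>Ys.
        complex_of_real (Q z x y) = outcome_prob d1 d2 a b \<rho> E F P z x y)}"

definition success_prob ::
  "'x set \<Rightarrow> 'y set \<Rightarrow> ('x \<Rightarrow> 'y \<Rightarrow> 'z) \<Rightarrow> ('z \<Rightarrow> 'x \<Rightarrow> 'y \<Rightarrow> real) \<Rightarrow> real" where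
  "success_prob Xs Ys f Q =
     1 / (real (card Xs) * real (card Ys)) * (\<Sum>x\<in>Xs. \<Sum>y\<in>Ys. Q (f x y) x y)"

text \<open>For \<open>d1, d2 \<ge> 1\<close> the set \<open>QE\<close> is nonempty and its success probabilities lie in \<open>[0, 1]\<close>, so
  the supremum may be taken in the reals.\<close>

definition max_success_prob ::
  "'x set \<Rightarrow> 'y set \<Rightarrow> ('x \<Rightarrow> 'y \<Rightarrow> 'z) \<Rightarrow> ('z \<Rightarrow> 'x \<Rightarrow> 'y \<Rightarrow> real) set \<Rightarrow> real" where
  "max_success_prob Xs Ys f S = (SUP Q\<in>S. success_prob Xs Ys f Q)"

text \<open>\<open>\<int>\<^sub>d\<^sup>2\<close> is represented by pairs of residues in \<open>{0..<d}\<close>.\<close>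

definition Zd2 :: "nat \<Rightarrow> (nat \<times> nat) set" where
  "Zd2 d = {0..<d} \<times> {0..<d}"

definition oplus2 :: "nat \<Rightarrow> nat \<times> nat \<Rightarrow> nat \<times> nat \<Rightarrow> nat \<times> nat" where
  "oplus2 d u v = ((fst u + fst v) mod d, (snd u + snd v) mod d)"

definition shift_mat :: "nat \<Rightarrow> complex mat" where
  "shift_mat d = mat d d (\<lambda>(i, q). if i = (q + 1) mod d then 1 else 0)"

definition clock_mat :: "nat \<Rightarrow> complex mat" where
  "clock_mat d = mat d d (\<lambda>(i, q). if i = q then exp (2 * of_real pi * \<i> / of_nat d) ^ q else 0)"

definition weyl :: "nat \<Rightarrow> nat \<times> nat \<Rightarrow> complex mat" where
  "weyl d u = shift_mat d ^\<^sub>m fst u * clock_mat d ^\<^sub>m snd u"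

definition max_entangled :: "nat \<Rightarrow> complex vec" where
  "max_entangled d = vec (d * d) (\<lambda>k. if k div d = k mod d then 1 / of_real (sqrt (real d)) else 0)"

definition bell_vec :: "nat \<Rightarrow> nat \<times> nat \<Rightarrow> complex vec" where
  "bell_vec d u = kron (weyl d u) (1\<^sub>m d) *\<^sub>v max_entangled d"

definition ketbra :: "complex vec \<Rightarrow> complex mat" where
  "ketbra v = mat (dim_vec v) (dim_vec v) (\<lambda>(i, j). v $ i * cnj (v $ j))"

definition conjugation_map :: "complex mat \<Rightarrow> complex mat \<Rightarrow> complex mat" where
  "conjugation_map U M = U * M * mat_adjoint U"

text \<open>The dense network coding protocol.  Since the senders forward their systems noiselessly,
  the local channels are just the unitary encodings.\<close>

definition dnc_state :: "nat \<Rightarrow> complex mat" where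
  "dnc_state d = ketbra (max_entangled d)"

definition dnc_sender1 :: "nat \<Rightarrow> nat \<times> nat \<Rightarrow> complex mat \<Rightarrow> complex mat" where
  "dnc_sender1 d u = conjugation_map (weyl d u)"

definition dnc_sender2 :: "nat \<Rightarrow> nat \<times> nat \<Rightarrow> complex mat \<Rightarrow> complex mat" where
  "dnc_sender2 d v = conjugation_map (transpose_mat (weyl d v))"

definition dnc_measurement :: "nat \<Rightarrow> nat \<times> nat \<Rightarrow> complex mat" where
  "dnc_measurement d w = ketbra (bell_vec d w)"

end

theory Submission
  imports Defs
begin

text \<open>Perfection of the protocol: \<open>(I \<otimes> W\<^sup>T) \<Phi> = (W \<otimes> I) \<Phi>\<close> moves both Weyl operators onto the first
  system, where their product is the Weyl operator of the sum up to a phase.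

  Converse: fix the input of Sender 2.  Trace preservation makes the receiver's reduced state \<open>B\<close> on
  the second system independent of the input of Sender 1, and every bipartite state is dominated by
  \<open>d1\<close> times \<open>I \<otimes> B\<close>.  As the outputs for distinct inputs of Sender 1 are distinct, their success
  probabilities sum to at most \<open>d1 Tr (I \<otimes> B) = d1\<^sup>2\<close>, so the average is at most \<open>d1\<^sup>2 / d\<^sup>2 \<le> 1/4\<close> as soon
  as \<open>d1 < d\<close>.  Exchanging the senders gives the same for \<open>d2\<close>.\<close>

section \<open>Positive semidefinite kernels on finite sets\<close>

text \<open>The shared state may live on systems of any finite dimension, so compactness is not at
  hand and the supremum may fail to be attained: showing that each single strategy succeeds with
  probability below 1 would not give a strict inequality. A bound that does not involve the
  dimensions of the shared systems is required, and the domination by \<open>d1\<close> times the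
  identity tensor the marginal provides it. The factor \<open>d1\<close> cannot be lowered, as a
  maximally entangled state on two \<open>d1\<close>-dimensional systems shows, and superdense
  coding attains the resulting total \<open>d1^2\<close>. Positivity is carried by kernels on
  arbitrary finite index sets because the argument restricts to blocks, exchanges tensor factors and
  sums out one index; on matrices indexed by \<open>{..<a * b}\<close> each of these would be
  arithmetic with \<open>div\<close> and \<open>mod\<close>. The order on complex numbers does
  double duty: a nonnegative value is real, so Hermiticity of kernels and reality of probabilities
  come as consequences.\<close>

definition psd_on :: "'i set \<Rightarrow> ('i \<Rightarrow> 'i \<Rightarrow> complex) \<Rightarrow> bool" where
  "psd_on S K \<longleftrightarrow> (\<forall>v. 0 \<le> (\<Sum>p\<in>S. \<Sum>q\<in>S. K p q * v q * cnj (v p)))"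

lemma psd_onI: "(\<And>v. 0 \<le> (\<Sum>p\<in>S. \<Sum>q\<in>S. K p q * v q * cnj (v p))) \<Longrightarrow> psd_on S K"
  by (simp add: psd_on_def)

lemma psd_onD: "psd_on S K \<Longrightarrow> 0 \<le> (\<Sum>p\<in>S. \<Sum>q\<in>S. K p q * v q * cnj (v p))"
  by (simp add: psd_on_def)

lemma psd_on_cong:
  "(\<And>p q. p \<in> S \<Longrightarrow> q \<in> S \<Longrightarrow> K p q = L p q) \<Longrightarrow> psd_on S K \<longleftrightarrow> psd_on S L"
  by (simp add: psd_on_def cong: sum.cong)

text \<open>Extending a vector on \<open>T\<close> by zero to \<open>S\<close> leaves the quadratic
  form unchanged.\<close>

lemma psd_on_subset:
  fixes K :: "'i \<Rightarrow> 'i \<Rightarrow> complex"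
  assumes "psd_on S K" "finite S" "T \<subseteq> S"
  shows "psd_on T K"
proof (rule psd_onI)
  fix v :: "'i \<Rightarrow> complex"
  define w where "w = (\<lambda>p. if p \<in> T then v p else 0)"
  have "(\<Sum>p\<in>T. \<Sum>q\<in>T. K p q * v q * cnj (v p)) = (\<Sum>p\<in>T. \<Sum>q\<in>S. K p q * w q * cnj (w p))"
    by (intro sum.cong refl sum.mono_neutral_cong_left) (use assms in \<open>auto simp: w_def\<close>)
  also have "\<dots> = (\<Sum>p\<in>S. \<Sum>q\<in>S. K p q * w q * cnj (w p))"
    by (intro sum.mono_neutral_left) (use assms in \<open>auto simp: w_def\<close>)
  finally show "0 \<le> (\<Sum>p\<in>T. \<Sum>q\<in>T. K p q * v q * cnj (v p))"
    using psd_onD[OF assms(1)] by simp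
qed

lemma psd_on_reindex:
  fixes K :: "'b \<Rightarrow> 'b \<Rightarrow> complex"
  assumes "bij_betw h S T"
  shows "psd_on S (\<lambda>p q. K (h p) (h q)) \<longleftrightarrow> psd_on T K"
proof -
  have eq: "(\<Sum>p\<in>T. \<Sum>q\<in>T. K p q * v q * cnj (v p)) =
      (\<Sum>p\<in>S. \<Sum>q\<in>S. K (h p) (h q) * v (h q) * cnj (v (h p)))" for v :: "'b \<Rightarrow> complex"
    by (simp add: sum.reindex_bij_betw[OF assms, symmetric])
  show ?thesis
  proof
    assume L: "psd_on S (\<lambda>p q. K (h p) (h q))"
    show "psd_on T K"
      by (rule psd_onI) (use eq psd_onD[OF L] in simp)
  next
    assume R: "psd_on T K"
    show "psd_on S (\<lambda>p q. K (h p) (h q))"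
    proof (rule psd_onI)
      fix v
      have "(\<Sum>p\<in>S. \<Sum>q\<in>S. K (h p) (h q) * v q * cnj (v p)) =
        (\<Sum>p\<in>S. \<Sum>q\<in>S. K (h p) (h q) * v (the_inv_into S h (h q)) * cnj (v (the_inv_into S h (h p))))"
        using assms by (intro sum.cong refl) (auto simp: bij_betw_def the_inv_into_f_f)
      then show "0 \<le> (\<Sum>p\<in>S. \<Sum>q\<in>S. K (h p) (h q) * v q * cnj (v p))"
        using psd_onD[OF R, of "\<lambda>p. v (the_inv_into S h p)"] eq[of "\<lambda>p. v (the_inv_into S h p)"]
        by simp
    qed
  qed
qed

lemma psd_on_diag:
  assumes "psd_on S K" "finite S" "p \<in> S"
  shows "0 \<le> K p p"
  using psd_onD[OF psd_on_subset[OF assms(1,2), of "{p}"], of "\<lambda>_. 1"] assms by simp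

text \<open>The quadratic form of a 2 by 2 principal block; it is the source of Hermiticity and of
  the vanishing of rows with zero diagonal.\<close>

lemma psd_on_pair:
  assumes "psd_on S K" "finite S" "p \<in> S" "q \<in> S" "p \<noteq> q"
  shows "0 \<le> K p p * (x * cnj x) + K p q * y * cnj x + K q p * x * cnj y + K q q * (y * cnj y)"
  using psd_onD[OF psd_on_subset[OF assms(1,2), of "{p, q}"], of "\<lambda>r. if r = p then x else y"] assms
  by (auto simp: algebra_simps)

text \<open>Nonnegative complex numbers are real, so the test vectors (1, 1) and (1, \<i>) determine
  the imaginary part of \<open>K p q + K q p\<close> and the real part of their difference.\<close>

lemma psd_on_hermitian:
  assumes "psd_on S K" "finite S" "p \<in> S" "q \<in> S"
  shows "K q p = cnj (K p q)"
proof (cases "p = q")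
  case True
  then show ?thesis using psd_on_diag[OF assms(1-3)] by (simp add: less_eq_complex_def complex_eq_iff)
next
  case False
  from psd_on_pair[OF assms False, of 1 1] psd_on_pair[OF assms False, of 1 \<i>]
    psd_on_diag[OF assms(1-3)] psd_on_diag[OF assms(1,2,4)]
  show ?thesis by (simp add: less_eq_complex_def complex_eq_iff)
qed

lemma psd_on_zero_diag:
  assumes "psd_on S K" "finite S" "p \<in> S" "q \<in> S" "K p p = 0"
  shows "K p q = 0"
proof (rule ccontr)
  assume nz: "K p q \<noteq> 0"
  then have "p \<noteq> q" using assms by auto
  define t where "t = (norm (K p q))\<^sup>2"
  have t: "t > 0" using nz by (simp add: t_def)
  have kk: "K p q * cnj (K p q) = of_real t"
    unfolding t_def by (rule complex_norm_square[symmetric])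
  \<comment> \<open>If the entry were nonzero, the test vector with components
    \<open>- x * K p q\<close> and 1 would give the value \<open>K q q - 2 * x * t\<close>. This
    \<open>x\<close> brings its real part to -1.\<close>
  define x :: real where "x = (Re (K q q) + 1) / (2 * t)"
  have "0 \<le> K p q * cnj (- of_real x * K p q) + K q p * (- of_real x * K p q) + K q q"
    using psd_on_pair[OF assms(1-4) \<open>p \<noteq> q\<close>, of "- of_real x * K p q" 1] assms(5) by simp
  also have "\<dots> = K q q - of_real (2 * x) * (K p q * cnj (K p q))"
    using psd_on_hermitian[OF assms(1-4)] by (simp add: algebra_simps)
  also have "\<dots> = K q q - of_real (Re (K q q) + 1)"
    unfolding kk of_real_mult[symmetric] x_def using t by (simp add: field_simps)
  finally show False by (simp add: less_eq_complex_def)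
qed

text \<open>The outer-product decomposition is Cholesky's: split off one basis vector and pass to the
  Schur complement.\<close>

lemma psd_on_decomposition:
  assumes "finite S" "psd_on S K"
  shows "\<exists>w. \<forall>p\<in>S. \<forall>q\<in>S. K p q = (\<Sum>c\<in>S. w c p * cnj (w c q))"
  using assms
proof (induction S arbitrary: K rule: finite_induct)
  case empty
  then show ?case by simp
next
  case (insert s S)
  let ?T = "insert s S"
  have fin: "finite ?T" using insert by simp
  note P = insert.prems
  have her: "K q p = cnj (K p q)" if "p \<in> ?T" "q \<in> ?T" for p q
    using psd_on_hermitian[OF P fin that] .
  define k where "k = Re (K s s)"
  have k: "K s s = of_real k" "k \<ge> 0"
    using psd_on_diag[OF P fin, of s] by (auto simp: less_eq_complex_def k_def complex_eq_iff)
  \<comment> \<open>The normalised column at \<open>s\<close>. For \<open>k = 0\<close> division by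
    zero makes \<open>u\<close> vanish, which is the right value: a zero diagonal entry forces the
    whole row and column to be zero.\<close>
  define u where "u = (\<lambda>p. K p s / of_real (sqrt k))"
  have sq: "of_real (sqrt k) * of_real (sqrt k) = (of_real k :: complex)"
    using k(2) by (simp flip: of_real_mult)
  have zero: "K p s = 0 \<and> K s p = 0" if "k = 0" "p \<in> ?T" for p
    using psd_on_zero_diag[OF P fin, of s p] k that her[of s p] by auto
  have us: "u p * cnj (u s) = K p s" if "p \<in> ?T" for p
  proof (cases "k = 0")
    case True
    then show ?thesis using zero[OF True that] by (simp add: u_def)
  next
    case False
    then show ?thesis using sq k(1) by (simp add: u_def mult.assoc)
  qed
  have su: "u s * cnj (u p) = K s p" if "p \<in> ?T" for p
    using arg_cong[OF us[OF that], of cnj] her[of p s] that by (simp add: mult.commute)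
  have uu: "u p * cnj (u q) = K p s * K s q / of_real k" if "p \<in> ?T" "q \<in> ?T" for p q
  proof -
    have "u p * cnj (u q) = K p s * K s q / (of_real (sqrt k) * of_real (sqrt k))"
      using her[of q s] that by (simp add: u_def)
    then show ?thesis unfolding sq .
  qed
  define K' where "K' = (\<lambda>p q. K p q - u p * cnj (u q))"
  have "psd_on S K'"
  proof (rule psd_onI)
    fix v
    define L where "L = (\<Sum>q\<in>S. K s q * v q)"
    have cL: "cnj L = (\<Sum>p\<in>S. K p s * cnj (v p))"
      unfolding L_def cnj_sum by (intro sum.cong refl) (simp add: her[of s])
    \<comment> \<open>Completing the square: for \<open>k > 0\<close> the value at \<open>s\<close>
      that minimises the form of \<open>K\<close> over all extensions of \<open>v\<close> is
      \<open>- L / k\<close>, and the minimum is the form of the Schur complement at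
      \<open>v\<close>. For \<open>k = 0\<close> both quotients are 0 and the identity still
      holds.\<close>
    define w where "w = (\<lambda>p. if p = s then - L / of_real k else v p)"
    have wS: "w p = v p" if "p \<in> S" for p using that insert.hyps by (auto simp: w_def)
    have ws: "w s = - L / of_real k" by (simp add: w_def)
    have "(\<Sum>p\<in>S. \<Sum>q\<in>S. K' p q * v q * cnj (v p)) =
      (\<Sum>p\<in>S. \<Sum>q\<in>S. K p q * v q * cnj (v p)) - (\<Sum>p\<in>S. \<Sum>q\<in>S. (K p s * cnj (v p)) * (K s q * v q)) / of_real k"
      unfolding sum_divide_distrib sum_subtractf[symmetric]
      by (intro sum.cong refl) (simp add: K'_def uu algebra_simps)
    also have "(\<Sum>p\<in>S. \<Sum>q\<in>S. (K p s * cnj (v p)) * (K s q * v q)) = cnj L * L"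
      unfolding cL unfolding L_def by (rule sum_product[symmetric])
    also have "(\<Sum>p\<in>S. \<Sum>q\<in>S. K p q * v q * cnj (v p)) - cnj L * L / of_real k =
       (\<Sum>p\<in>?T. \<Sum>q\<in>?T. K p q * w q * cnj (w p))"
    proof -
      have "(\<Sum>p\<in>?T. \<Sum>q\<in>?T. K p q * w q * cnj (w p)) =
        K s s * w s * cnj (w s) + (\<Sum>q\<in>S. K s q * v q) * cnj (w s) +
        (\<Sum>p\<in>S. K p s * cnj (v p)) * w s + (\<Sum>p\<in>S. \<Sum>q\<in>S. K p q * v q * cnj (v p))"
        using insert.hyps
        by (simp add: sum.distrib sum_distrib_left sum_distrib_right wS algebra_simps cong: sum.cong)
      also have "\<dots> = (\<Sum>p\<in>S. \<Sum>q\<in>S. K p q * v q * cnj (v p)) - cnj L * L / of_real k"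
        unfolding cL[symmetric] L_def[symmetric] ws k(1)
        by (cases "k = 0") (simp_all add: field_simps)
      finally show ?thesis by simp
    qed
    finally show "0 \<le> (\<Sum>p\<in>S. \<Sum>q\<in>S. K' p q * v q * cnj (v p))"
      using psd_onD[OF P] by simp
  qed
  from insert.IH[OF this] obtain w
    where w: "\<forall>p\<in>S. \<forall>q\<in>S. K' p q = (\<Sum>c\<in>S. w c p * cnj (w c q))" by blast
  \<comment> \<open>The rank-one terms are labelled by the index set itself: \<open>s\<close> labels
    the split-off column, and the vectors from the induction hypothesis are extended by zero at
    \<open>s\<close>.\<close>
  define w' where "w' = (\<lambda>c p. if c = s then u p else if p = s then 0 else w c p)"
  have "K p q = (\<Sum>c\<in>?T. w' c p * cnj (w' c q))" if "p \<in> ?T" "q \<in> ?T" for p q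
  proof -
    have "(\<Sum>c\<in>?T. w' c p * cnj (w' c q)) = u p * cnj (u q) + (\<Sum>c\<in>S. w' c p * cnj (w' c q))"
      using insert.hyps by (simp add: w'_def)
    also have "(\<Sum>c\<in>S. w' c p * cnj (w' c q)) = (if p = s \<or> q = s then 0 else K' p q)"
    proof (cases "p = s \<or> q = s")
      case True
      then show ?thesis using insert.hyps by (auto simp: w'_def intro!: sum.neutral)
    next
      case False
      then have "K' p q = (\<Sum>c\<in>S. w c p * cnj (w c q))" using w that by auto
      with False show ?thesis using insert.hyps by (auto simp: w'_def intro!: sum.cong)
    qed
    finally show ?thesis using us[OF that(1)] su[OF that(2)] by (auto simp: K'_def)
  qed
  then show ?case by blast
qed

text \<open>With \<open>L\<close> written as a sum of rank-one kernels, the trace of the product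
  becomes a sum of values of the quadratic form of \<open>K\<close>.\<close>

lemma psd_on_trace_mult_nonneg:
  assumes "finite S" "psd_on S K" "psd_on S L"
  shows "0 \<le> (\<Sum>p\<in>S. \<Sum>q\<in>S. K p q * L q p)"
proof -
  obtain w where w: "\<forall>p\<in>S. \<forall>q\<in>S. L p q = (\<Sum>c\<in>S. w c p * cnj (w c q))"
    using psd_on_decomposition[OF assms(1,3)] by blast
  have "(\<Sum>p\<in>S. \<Sum>q\<in>S. K p q * L q p) = (\<Sum>p\<in>S. \<Sum>q\<in>S. \<Sum>c\<in>S. K p q * w c q * cnj (w c p))"
    using w by (intro sum.cong refl) (simp add: sum_distrib_left mult.assoc)
  also have "\<dots> = (\<Sum>p\<in>S. \<Sum>c\<in>S. \<Sum>q\<in>S. K p q * w c q * cnj (w c p))"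
    by (intro sum.cong refl sum.swap)
  also have "\<dots> = (\<Sum>c\<in>S. \<Sum>p\<in>S. \<Sum>q\<in>S. K p q * w c q * cnj (w c p))"
    by (rule sum.swap)
  finally show ?thesis using psd_onD[OF assms(2)] by (simp add: sum_nonneg)
qed

section \<open>The superdense coding bound\<close>

lemma sum_Times: "(\<Sum>p\<in>A \<times> B. f p) = (\<Sum>i\<in>A. \<Sum>m\<in>B. f (i, m))"
  by (simp add: sum.cartesian_product)

lemma psd_on_block:
  assumes "finite I" "finite J" "psd_on (I \<times> J) K" "i \<in> I"
  shows "psd_on J (\<lambda>m n. K (i, m) (i, n))"
proof -
  have "psd_on (Pair i ` J) K"
    by (rule psd_on_subset[OF assms(3)]) (use assms in auto)
  moreover have "bij_betw (Pair i) J (Pair i ` J)"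
    by (simp add: bij_betw_def inj_on_def)
  ultimately show ?thesis
    using psd_on_reindex by blast
qed

text \<open>The partial trace is the sum of the diagonal blocks, each of which is a restriction of
  \<open>K\<close>.\<close>

lemma psd_on_partial_trace:
  assumes "finite I" "finite J" "psd_on (I \<times> J) K"
  shows "psd_on J (\<lambda>m n. \<Sum>i\<in>I. K (i, m) (i, n))"
proof (rule psd_onI)
  fix v
  have "0 \<le> (\<Sum>m\<in>J. \<Sum>n\<in>J. K (i, m) (i, n) * v n * cnj (v m))" if "i \<in> I" for i
    by (rule psd_onD[OF psd_on_block[OF assms that]])
  then have "0 \<le> (\<Sum>i\<in>I. \<Sum>m\<in>J. \<Sum>n\<in>J. K (i, m) (i, n) * v n * cnj (v m))"
    by (rule sum_nonneg)
  also have "\<dots> = (\<Sum>m\<in>J. \<Sum>n\<in>J. \<Sum>i\<in>I. K (i, m) (i, n) * v n * cnj (v m))"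
    by (simp add: sum.swap[of _ J I])
  finally show "0 \<le> (\<Sum>m\<in>J. \<Sum>n\<in>J. (\<Sum>i\<in>I. K (i, m) (i, n)) * v n * cnj (v m))"
    by (simp add: sum_distrib_right)
qed

lemma psd_on_identity_tensor:
  assumes "finite I" "psd_on J B"
  shows "psd_on (I \<times> J) (\<lambda>p q. if fst p = fst q then B (snd p) (snd q) else 0)"
proof (rule psd_onI)
  fix v :: "'a \<times> 'b \<Rightarrow> complex"
  have "(\<Sum>p\<in>I \<times> J. \<Sum>q\<in>I \<times> J. (if fst p = fst q then B (snd p) (snd q) else 0) * v q * cnj (v p))
    = (\<Sum>i\<in>I. \<Sum>m\<in>J. \<Sum>j\<in>I. \<Sum>n\<in>J. if i = j then B m n * v (j, n) * cnj (v (i, m)) else 0)"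
    unfolding sum_Times by (intro sum.cong refl) simp
  also have "\<dots> = (\<Sum>i\<in>I. \<Sum>m\<in>J. \<Sum>n\<in>J. B m n * v (i, n) * cnj (v (i, m)))"
    using assms(1) by (simp add: sum.swap[of _ J I] sum.delta')
  finally show "0 \<le> (\<Sum>p\<in>I \<times> J. \<Sum>q\<in>I \<times> J. (if fst p = fst q then B (snd p) (snd q) else 0) * v q * cnj (v p))"
    using psd_onD[OF assms(2)] by (simp add: sum_nonneg)
qed

text \<open>With \<open>S i j\<close> the block form at \<open>v i, v j\<close>, convexity of the quadratic form gives
  \<open>\<Sum>\<^sub>i\<^sub>j S i j \<le> |I| \<Sum>\<^sub>i S i i\<close>, and each \<open>S i i\<close> is bounded by the partial trace form at \<open>v i\<close>.\<close>

lemma psd_on_reduction: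
  assumes fin: "finite I" "finite J" and K: "psd_on (I \<times> J) K"
  shows "psd_on (I \<times> J) (\<lambda>p q. (if fst p = fst q then of_nat (card I) *
     (\<Sum>i\<in>I. K (i, snd p) (i, snd q)) else 0) - K p q)"
proof (rule psd_onI)
  fix v :: "'a \<times> 'b \<Rightarrow> complex"
  let ?S = "\<lambda>i j. \<Sum>m\<in>J. \<Sum>n\<in>J. K (i, m) (j, n) * v (j, n) * cnj (v (i, m))"
  let ?R = "\<lambda>k i. \<Sum>m\<in>J. \<Sum>n\<in>J. K (k, m) (k, n) * v (i, n) * cnj (v (i, m))"
  have block: "0 \<le> (\<Sum>m\<in>J. \<Sum>n\<in>J. K (k, m) (k, n) * w n * cnj (w m))" if "k \<in> I" for k w
    by (rule psd_onD[OF psd_on_block[OF fin K that]])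
  have diff: "0 \<le> ?S i i - ?S i j - ?S j i + ?S j j" if "i \<in> I" "j \<in> I" for i j
  proof (cases "i = j")
    case True
    then show ?thesis by simp
  next
    case False
    have sub: "psd_on ({i, j} \<times> J) K"
      by (rule psd_on_subset[OF K]) (use fin that in auto)
    \<comment> \<open>The test vector is \<open>v\<close> on block \<open>i\<close> and
      \<open>- v\<close> on block \<open>j\<close>, so that exactly the two cross terms change
      sign.\<close>
    have "0 \<le> (\<Sum>p\<in>{i, j} \<times> J. \<Sum>q\<in>{i, j} \<times> J. K p q *
       (if fst q = i then v q else - v q) * cnj (if fst p = i then v p else - v p))"
      by (rule psd_onD[OF sub])
    also have "\<dots> = (\<Sum>k\<in>{i, j}. \<Sum>m\<in>J. \<Sum>l\<in>{i, j}. \<Sum>n\<in>J. K (k, m) (l, n) *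
       (if l = i then v (l, n) else - v (l, n)) * cnj (if k = i then v (k, m) else - v (k, m)))"
      unfolding sum_Times by (intro sum.cong refl) simp
    also have "\<dots> = ?S i i - ?S i j - ?S j i + ?S j j"
      using False by (simp add: sum.distrib sum_negf sum_subtractf)
    finally show ?thesis .
  qed
  have "0 \<le> (\<Sum>i\<in>I. \<Sum>j\<in>I. ?S i i - ?S i j - ?S j i + ?S j j)"
    by (intro sum_nonneg diff)
  also have "\<dots> = 2 * (of_nat (card I) * (\<Sum>i\<in>I. ?S i i) - (\<Sum>i\<in>I. \<Sum>j\<in>I. ?S i j))"
  proof -
    have "(\<Sum>i\<in>I. \<Sum>j\<in>I. ?S j i) = (\<Sum>i\<in>I. \<Sum>j\<in>I. ?S i j)"
      by (rule sum.swap)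
    then show ?thesis
      by (simp add: sum.distrib sum_subtractf sum_distrib_left algebra_simps)
  qed
  finally have "(\<Sum>i\<in>I. \<Sum>j\<in>I. ?S i j) \<le> of_nat (card I) * (\<Sum>i\<in>I. ?S i i)"
    by (simp add: less_eq_complex_def)
  also have "\<dots> \<le> of_nat (card I) * (\<Sum>i\<in>I. \<Sum>k\<in>I. ?R k i)"
  proof (intro mult_left_mono sum_mono)
    fix i assume i: "i \<in> I"
    have "?R i i \<le> (\<Sum>k\<in>I. ?R k i)"
      by (rule member_le_sum[OF i]) (use block fin in auto)
    then show "?S i i \<le> (\<Sum>k\<in>I. ?R k i)" .
  qed (simp add: less_eq_complex_def)
  finally have main: "0 \<le> of_nat (card I) * (\<Sum>i\<in>I. \<Sum>k\<in>I. ?R k i) - (\<Sum>i\<in>I. \<Sum>j\<in>I. ?S i j)"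
    by simp
  have "(\<Sum>p\<in>I \<times> J. \<Sum>q\<in>I \<times> J. ((if fst p = fst q then of_nat (card I) *
     (\<Sum>i\<in>I. K (i, snd p) (i, snd q)) else 0) - K p q) * v q * cnj (v p)) =
     (\<Sum>i\<in>I. \<Sum>m\<in>J. \<Sum>j\<in>I. \<Sum>n\<in>J. (if i = j then of_nat (card I) *
     ((\<Sum>k\<in>I. K (k, m) (k, n)) * v (j, n) * cnj (v (i, m))) else 0) - K (i, m) (j, n) * v (j, n) * cnj (v (i, m)))"
    unfolding sum_Times by (intro sum.cong refl) (simp add: algebra_simps)
  also have "\<dots> = of_nat (card I) * (\<Sum>i\<in>I. \<Sum>k\<in>I. ?R k i) - (\<Sum>i\<in>I. \<Sum>j\<in>I. ?S i j)"
  proof -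
    have a: "(\<Sum>m\<in>J. \<Sum>j\<in>I. \<Sum>n\<in>J. if i = j then of_nat (card I) *
     ((\<Sum>k\<in>I. K (k, m) (k, n)) * v (j, n) * cnj (v (i, m))) else 0) = of_nat (card I) * (\<Sum>k\<in>I. ?R k i)"
      if "i \<in> I" for i
    proof -
      have "(\<Sum>m\<in>J. \<Sum>j\<in>I. \<Sum>n\<in>J. if i = j then of_nat (card I) *
         ((\<Sum>k\<in>I. K (k, m) (k, n)) * v (j, n) * cnj (v (i, m))) else 0) =
        (\<Sum>m\<in>J. \<Sum>j\<in>I. if i = j then (\<Sum>n\<in>J. of_nat (card I) *
         ((\<Sum>k\<in>I. K (k, m) (k, n)) * v (j, n) * cnj (v (i, m)))) else 0)"
        by (intro sum.cong refl) simp
      also have "\<dots> = of_nat (card I) * (\<Sum>m\<in>J. \<Sum>n\<in>J. \<Sum>k\<in>I. K (k, m) (k, n) * v (i, n) * cnj (v (i, m)))"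
        using that fin by (simp add: sum_distrib_left sum_distrib_right)
      also have "(\<Sum>m\<in>J. \<Sum>n\<in>J. \<Sum>k\<in>I. K (k, m) (k, n) * v (i, n) * cnj (v (i, m))) = (\<Sum>k\<in>I. ?R k i)"
        by (simp add: sum.swap[of _ I J])
      finally show ?thesis .
    qed
    have b: "(\<Sum>m\<in>J. \<Sum>j\<in>I. \<Sum>n\<in>J. K (i, m) (j, n) * v (j, n) * cnj (v (i, m))) = (\<Sum>j\<in>I. ?S i j)" for i
      by (rule sum.swap)
    show ?thesis
      by (simp add: sum_subtractf a b sum_distrib_left)
  qed
  finally show "0 \<le> (\<Sum>p\<in>I \<times> J. \<Sum>q\<in>I \<times> J. ((if fst p = fst q then of_nat (card I) *
     (\<Sum>i\<in>I. K (i, snd p) (i, snd q)) else 0) - K p q) * v q * cnj (v p))"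
    using main by simp
qed

lemma superdense_bound:
  fixes P :: "'z \<Rightarrow> 'i \<times> 'j \<Rightarrow> 'i \<times> 'j \<Rightarrow> complex"
  assumes fin: "finite I" "finite J" "finite Zs"
    and P: "\<And>z. z \<in> Zs \<Longrightarrow> psd_on (I \<times> J) (P z)"
    and P1: "\<And>p q. p \<in> I \<times> J \<Longrightarrow> q \<in> I \<times> J \<Longrightarrow> (\<Sum>z\<in>Zs. P z p q) = (if p = q then 1 else 0)"
    and T: "\<And>x. x \<in> Xs \<Longrightarrow> psd_on (I \<times> J) (T x)"
    and B: "\<And>x m n. x \<in> Xs \<Longrightarrow> m \<in> J \<Longrightarrow> n \<in> J \<Longrightarrow> (\<Sum>i\<in>I. T x (i, m) (i, n)) = B m n"
    and trB: "(\<Sum>m\<in>J. B m m) = 1"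
    and g: "inj_on g Xs" "g ` Xs \<subseteq> Zs"
  shows "(\<Sum>x\<in>Xs. \<Sum>p\<in>I \<times> J. \<Sum>q\<in>I \<times> J. P (g x) p q * T x q p) \<le> of_nat ((card I)\<^sup>2)"
\<comment> \<open>Positivity of \<open>B\<close> is inherited from the states that have it as
  marginal, so at least one input is required.\<close>
proof (cases "Xs = {}")
  case True
  then show ?thesis by (simp add: less_eq_complex_def)
next
  case False
  let ?c = "of_nat (card I) :: complex"
  let ?IJ = "I \<times> J"
  have c0: "0 \<le> ?c" by (simp add: less_eq_complex_def)
  define D where "D = (\<lambda>(p :: 'i \<times> 'j) (q :: 'i \<times> 'j). if fst p = fst q then B (snd p) (snd q) else 0 :: complex)"
  have finp: "finite ?IJ" using fin by simp
  have psdB: "psd_on J B"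
  proof -
    obtain x where x: "x \<in> Xs" using False by blast
    have "psd_on J (\<lambda>m n. \<Sum>i\<in>I. T x (i, m) (i, n))"
      using psd_on_partial_trace fin T[OF x] by blast
    then show ?thesis using B[OF x] psd_on_cong by (metis (no_types, lifting))
  qed
  have psdD: "psd_on ?IJ D"
    unfolding D_def by (rule psd_on_identity_tensor[OF fin(1) psdB])
  have le: "(\<Sum>p\<in>?IJ. \<Sum>q\<in>?IJ. P (g x) p q * T x q p) \<le> ?c * (\<Sum>p\<in>?IJ. \<Sum>q\<in>?IJ. P (g x) p q * D q p)"
    if x: "x \<in> Xs" for x
  proof -
    have "psd_on ?IJ (\<lambda>p q. (if fst p = fst q then ?c *
       (\<Sum>i\<in>I. T x (i, snd p) (i, snd q)) else 0) - T x p q)"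
      by (rule psd_on_reduction[OF fin(1,2) T[OF x]])
    moreover have "(if fst p = fst q then ?c *
       (\<Sum>i\<in>I. T x (i, snd p) (i, snd q)) else 0) - T x p q = ?c * D p q - T x p q"
      if "p \<in> ?IJ" "q \<in> ?IJ" for p q
      using B[OF x, of "snd p" "snd q"] that by (auto simp: D_def)
    ultimately have "psd_on ?IJ (\<lambda>p q. ?c * D p q - T x p q)"
      using psd_on_cong by (metis (no_types, lifting))
    moreover have "psd_on ?IJ (P (g x))" using P g x by blast
    ultimately have "0 \<le> (\<Sum>p\<in>?IJ. \<Sum>q\<in>?IJ. P (g x) p q * (?c * D q p - T x q p))"
      by (intro psd_on_trace_mult_nonneg finp)
    also have "\<dots> = ?c * (\<Sum>p\<in>?IJ. \<Sum>q\<in>?IJ. P (g x) p q * D q p) - (\<Sum>p\<in>?IJ. \<Sum>q\<in>?IJ. P (g x) p q * T x q p)"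
      by (simp add: algebra_simps sum_subtractf sum_distrib_left)
    finally show ?thesis by simp
  qed
  have "(\<Sum>x\<in>Xs. \<Sum>p\<in>?IJ. \<Sum>q\<in>?IJ. P (g x) p q * T x q p) \<le>
      (\<Sum>x\<in>Xs. ?c * (\<Sum>p\<in>?IJ. \<Sum>q\<in>?IJ. P (g x) p q * D q p))"
    by (intro sum_mono le)
  \<comment> \<open>Injectivity of \<open>g\<close> ensures that each measurement effect is counted
    at most once. Adding the nonnegative terms of the remaining outcomes then completes the effects
    to the identity.\<close>
  also have "\<dots> = ?c * (\<Sum>z\<in>g ` Xs. \<Sum>p\<in>?IJ. \<Sum>q\<in>?IJ. P z p q * D q p)"
    using g by (simp add: sum_distrib_left sum.reindex)
  also have "\<dots> \<le> ?c * (\<Sum>z\<in>Zs. \<Sum>p\<in>?IJ. \<Sum>q\<in>?IJ. P z p q * D q p)"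
    using g fin c0 psd_on_trace_mult_nonneg[OF finp P psdD] by (intro mult_left_mono sum_mono2) auto
  also have "(\<Sum>z\<in>Zs. \<Sum>p\<in>?IJ. \<Sum>q\<in>?IJ. P z p q * D q p) = (\<Sum>p\<in>?IJ. \<Sum>q\<in>?IJ. (\<Sum>z\<in>Zs. P z p q) * D q p)"
    by (simp add: sum_distrib_right sum.swap[of _ ?IJ Zs])
  also have "\<dots> = (\<Sum>p\<in>?IJ. \<Sum>q\<in>?IJ. if p = q then D q p else 0)"
    by (intro sum.cong refl) (simp add: P1)
  also have "\<dots> = (\<Sum>p\<in>?IJ. D p p)"
    using finp by simp
  also have "\<dots> = (\<Sum>i\<in>I. \<Sum>m\<in>J. B m m)"
    unfolding sum_Times D_def by simp
  also have "\<dots> = ?c" using trB by simp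
  finally show ?thesis by (simp add: power2_eq_square)
qed

section \<open>Tensor products of channels\<close>

lemma psd_iff_psd_on:
  "psd m A \<longleftrightarrow> A \<in> carrier_mat m m \<and> psd_on {..<m} (\<lambda>i j. A $$ (i, j))"
proof -
  have eq: "(A *\<^sub>v v) \<bullet>c v = (\<Sum>p<m. \<Sum>q<m. A $$ (p, q) * v $ q * cnj (v $ p))"
    if "A \<in> carrier_mat m m" "v \<in> carrier_vec m" for v
    using that by (auto simp: scalar_prod_def sum_distrib_right atLeast0LessThan intro!: sum.cong)
  show ?thesis
  proof (cases "A \<in> carrier_mat m m")
    case True
    have "(\<forall>v\<in>carrier_vec m. 0 \<le> (A *\<^sub>v v) \<bullet>c v) \<longleftrightarrow> psd_on {..<m} (\<lambda>i j. A $$ (i, j))"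
    proof
      assume L: "\<forall>v\<in>carrier_vec m. 0 \<le> (A *\<^sub>v v) \<bullet>c v"
      show "psd_on {..<m} (\<lambda>i j. A $$ (i, j))"
      proof (rule psd_onI)
        fix v :: "nat \<Rightarrow> complex"
        have "0 \<le> (A *\<^sub>v vec m v) \<bullet>c vec m v" using L by auto
        then show "0 \<le> (\<Sum>p<m. \<Sum>q<m. A $$ (p, q) * v q * cnj (v p))"
          by (subst (asm) eq[OF True]) simp_all
      qed
    next
      assume R: "psd_on {..<m} (\<lambda>i j. A $$ (i, j))"
      show "\<forall>v\<in>carrier_vec m. 0 \<le> (A *\<^sub>v v) \<bullet>c v"
        using psd_onD[OF R] eq[OF True] by simp
    qed
    then show ?thesis by (simp add: psd_def)
  qed (simp add: psd_def)
qed

section \<open>Tensor product indices as pairs\<close>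

definition pair_index :: "nat \<Rightarrow> nat \<times> nat \<Rightarrow> nat" where
  "pair_index b p = fst p * b + snd p"

text \<open>Views an operator on a tensor product as a kernel on pairs of basis labels, in the
  ordering that \<open>kron\<close> uses. Partial traces and the exchange of factors can then be
  written without division.\<close>

definition entry2 :: "nat \<Rightarrow> complex mat \<Rightarrow> nat \<times> nat \<Rightarrow> nat \<times> nat \<Rightarrow> complex" where
  "entry2 b M p q = M $$ (pair_index b p, pair_index b q)"

lemma pair_index_less: "i < a \<Longrightarrow> k < b \<Longrightarrow> i * b + k < a * (b :: nat)"
proof -
  assume "i < a" "k < b"
  then have "i * b + k < Suc i * b" by simp
  also have "\<dots> \<le> a * b" using \<open>i < a\<close> by (intro mult_le_mono1) simp
  finally show ?thesis .
qed

lemma bij_betw_pair_index: "bij_betw (pair_index b) ({..<a} \<times> {..<b}) {..<a * b}"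
  by (rule bij_betw_byWitness[where f' = "\<lambda>x. (x div b, x mod b)"])
    (auto simp: pair_index_def pair_index_less less_mult_imp_div_less intro!: mod_less_divisor gr0I)

lemma sum_pair_index:
  fixes a b :: nat
  shows "(\<Sum>x<a * b. f x) = (\<Sum>i<a. \<Sum>k<b. f (i * b + k))"
  using sum.reindex_bij_betw[OF bij_betw_pair_index[of b a], of f]
  by (simp add: sum_Times pair_index_def)

lemma psd_iff_entry2:
  "psd (a * b) M \<longleftrightarrow> M \<in> carrier_mat (a * b) (a * b) \<and> psd_on ({..<a} \<times> {..<b}) (entry2 b M)"
  unfolding psd_iff_psd_on entry2_def
  using psd_on_reindex[OF bij_betw_pair_index[of b a], of "\<lambda>i j. M $$ (i, j)"] by simp

lemma mat_trace_carrier: "A \<in> carrier_mat m m \<Longrightarrow> mat_trace A = (\<Sum>i<m. A $$ (i, i))"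
  by (auto simp: mat_trace_def)

lemma mat_trace_mult_pairs:
  assumes "A \<in> carrier_mat (a * b) (a * b)" "B \<in> carrier_mat (a * b) (a * b)"
  shows "mat_trace (A * B) =
    (\<Sum>p\<in>{..<a} \<times> {..<b}. \<Sum>q\<in>{..<a} \<times> {..<b}. entry2 b A p q * entry2 b B q p)"
proof -
  have "mat_trace (A * B) = (\<Sum>x<a * b. \<Sum>y<a * b. A $$ (x, y) * B $$ (y, x))"
    using assms by (subst mat_trace_carrier[of _ "a * b"])
      (auto simp: scalar_prod_def atLeast0LessThan intro!: sum.cong)
  then show ?thesis
    by (simp add: sum_pair_index sum_Times entry2_def pair_index_def)
qed

lemma unit_matrix_carrier [simp]: "unit_matrix a k l \<in> carrier_mat a a"
  by (simp add: unit_matrix_def)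

lemma mat_trace_unit_matrix: "k < a \<Longrightarrow> mat_trace (unit_matrix a k l) = (if k = l then 1 else 0)"
proof -
  assume k: "k < a"
  have "mat_trace (unit_matrix a k l) = (\<Sum>i<a. if i = k then (if k = l then 1 else 0) else 0)"
    unfolding mat_trace_def unit_matrix_def by (auto intro!: sum.cong)
  then show ?thesis using k by simp
qed

lemma tensor_map_carrier [simp]:
  "tensor_map a b a' b' E F M \<in> carrier_mat (b * b') (b * b')"
  by (simp add: tensor_map_def)

lemma entry2_tensor_map:
  assumes "\<And>k l. k < a \<Longrightarrow> l < a \<Longrightarrow> E (unit_matrix a k l) \<in> carrier_mat b b"
    "\<And>k l. k < a' \<Longrightarrow> l < a' \<Longrightarrow> F (unit_matrix a' k l) \<in> carrier_mat b' b'"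
    "i < b" "i' < b'" "j < b" "j' < b'"
  shows "entry2 b' (tensor_map a b a' b' E F M) (i, i') (j, j') =
    (\<Sum>k<a. \<Sum>l<a. \<Sum>k'<a'. \<Sum>l'<a'. entry2 a' M (k, k') (l, l') *
      (E (unit_matrix a k l) $$ (i, j) * F (unit_matrix a' k' l') $$ (i', j')))"
proof -
  have "kron (E (unit_matrix a k l)) (F (unit_matrix a' k' l')) $$ (i * b' + i', j * b' + j') =
    E (unit_matrix a k l) $$ (i, j) * F (unit_matrix a' k' l') $$ (i', j')"
    if "k < a" "l < a" "k' < a'" "l' < a'" for k l k' l'
    using assms(1)[OF that(1,2)] assms(2)[OF that(3,4)] assms(3-)
    by (simp add: kron_def pair_index_less)
  then show ?thesis
    using assms(3-)
    by (simp add: entry2_def pair_index_def tensor_map_def pair_index_less)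
qed

text \<open>Inverse direction of \<open>entry2\<close>: complete positivity speaks of matrices,
  while the intermediate objects of the argument are kernels.\<close>

definition mat_of_pairs :: "nat \<Rightarrow> nat \<Rightarrow> (nat \<times> nat \<Rightarrow> nat \<times> nat \<Rightarrow> complex) \<Rightarrow> complex mat" where
  "mat_of_pairs a b R =
     mat (a * b) (a * b) (\<lambda>(x, y). R (x div b, x mod b) (y div b, y mod b))"

lemma entry2_mat_of_pairs:
  "p \<in> {..<a} \<times> {..<b} \<Longrightarrow> q \<in> {..<a} \<times> {..<b} \<Longrightarrow> entry2 b (mat_of_pairs a b R) p q = R p q"
  by (auto simp: mat_of_pairs_def entry2_def pair_index_def pair_index_less)

lemma psd_on_swap:
  assumes "psd_on (I \<times> J) K"
  shows "psd_on (J \<times> I) (\<lambda>p q. K (prod.swap p) (prod.swap q))"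
proof -
  have "bij_betw prod.swap (J \<times> I) (I \<times> J)"
    by (auto simp: bij_betw_def inj_on_def)
  from psd_on_reindex[OF this] assms show ?thesis by blast
qed

lemma linear_map_mat_unit_carrier:
  "linear_map_mat a b E \<Longrightarrow> E (unit_matrix a k l) \<in> carrier_mat b b"
  by (simp add: linear_map_mat_def)

text \<open>The identity on the ancilla fixes every matrix unit, so the sums over ancilla indices
  collapse and only \<open>E\<close> acts. The dimension \<open>n\<close> of the ancilla is free,
  which allows the output to be fed into another map.\<close>

lemma completely_positive_psd_on:
  fixes n :: nat
  assumes E: "linear_map_mat a b E" "completely_positive a b E"
    and R: "psd_on ({..<a} \<times> {..<n}) R"
  shows "psd_on ({..<b} \<times> {..<n}) (\<lambda>p q. \<Sum>k<a. \<Sum>l<a.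
    R (k, snd p) (l, snd q) * E (unit_matrix a k l) $$ (fst p, fst q))"
proof -
  define M where "M = mat_of_pairs a n R"
  have M: "M \<in> carrier_mat (a * n) (a * n)"
    "\<And>p q. p \<in> {..<a} \<times> {..<n} \<Longrightarrow> q \<in> {..<a} \<times> {..<n} \<Longrightarrow> entry2 n M p q = R p q"
    unfolding M_def by (simp add: mat_of_pairs_def) (rule entry2_mat_of_pairs)
  have "psd_on ({..<a} \<times> {..<n}) (entry2 n M)"
    using R M(2) by (subst psd_on_cong[of _ _ R]) auto
  then have "psd (a * n) M" using M by (simp add: psd_iff_entry2)
  then have "psd (b * n) (tensor_map a b n n E (\<lambda>N. N) M)"
    using E by (simp add: completely_positive_def)
  then have "psd_on ({..<b} \<times> {..<n}) (entry2 n (tensor_map a b n n E (\<lambda>N. N) M))"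
    by (simp add: psd_iff_entry2)
  moreover have "entry2 n (tensor_map a b n n E (\<lambda>N. N) M) p q = (\<Sum>k<a. \<Sum>l<a.
    R (k, snd p) (l, snd q) * E (unit_matrix a k l) $$ (fst p, fst q))"
    if pq: "p \<in> {..<b} \<times> {..<n}" "q \<in> {..<b} \<times> {..<n}" for p q
  proof -
    obtain i i' j j' where [simp]: "p = (i, i')" "q = (j, j')"
      and lt: "i < b" "i' < n" "j < b" "j' < n" using pq by auto
    have "entry2 n (tensor_map a b n n E (\<lambda>N. N) M) p q =
      (\<Sum>k<a. \<Sum>l<a. \<Sum>k'<n. \<Sum>l'<n. entry2 n M (k, k') (l, l') *
        (E (unit_matrix a k l) $$ (i, j) * unit_matrix n k' l' $$ (i', j')))"
      unfolding \<open>p = _\<close> \<open>q = _\<close>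
      by (rule entry2_tensor_map) (use lt linear_map_mat_unit_carrier[OF E(1)] in auto)
    also have "\<dots> = (\<Sum>k<a. \<Sum>l<a. \<Sum>k'<n. \<Sum>l'<n.
      if l' = j' then if k' = i' then R (k, i') (l, j') * E (unit_matrix a k l) $$ (i, j) else 0 else 0)"
      using lt by (intro sum.cong refl) (auto simp: unit_matrix_def M(2))
    also have "\<dots> = (\<Sum>k<a. \<Sum>l<a. R (k, i') (l, j') * E (unit_matrix a k l) $$ (i, j))"
      using lt by simp
    finally show ?thesis by simp
  qed
  ultimately show ?thesis
    using psd_on_cong by (metis (no_types, lifting))
qed

lemma sum_swap_pairs:
  "(\<Sum>k\<in>A. \<Sum>l\<in>B. \<Sum>k'\<in>C. \<Sum>l'\<in>D. f k l k' l') = (\<Sum>k'\<in>C. \<Sum>l'\<in>D. \<Sum>k\<in>A. \<Sum>l\<in>B. f k l k' l')"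
  using sum.swap[of "\<lambda>p q. f (fst p) (snd p) (fst q) (snd q)" "C \<times> D" "A \<times> B"]
  by (simp add: sum_Times)

lemma entry2_tensor_map_channels:
  assumes "linear_map_mat a d1 E" "linear_map_mat b d2 F" "i < d1" "i' < d2" "j < d1" "j' < d2"
  shows "entry2 d2 (tensor_map a d1 b d2 E F \<rho>) (i, i') (j, j') =
    (\<Sum>k<a. \<Sum>l<a. \<Sum>k'<b. \<Sum>l'<b. entry2 b \<rho> (k, k') (l, l') *
      (E (unit_matrix a k l) $$ (i, j) * F (unit_matrix b k' l') $$ (i', j')))"
  by (rule entry2_tensor_map) (use assms linear_map_mat_unit_carrier in auto)

text \<open>The product of two channels is \<open>E\<close> on the first factor followed by
  \<open>F\<close> on the second. Complete positivity is defined with the ancilla as second factor,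
  so the factors are exchanged before \<open>F\<close> acts and exchanged back afterwards.\<close>

lemma psd_tensor_map:
  assumes E: "quantum_channel a d1 E" and F: "quantum_channel b d2 F" and \<rho>: "psd (a * b) \<rho>"
  shows "psd (d1 * d2) (tensor_map a d1 b d2 E F \<rho>)"
proof -
  define R where "R = entry2 b \<rho>"
  define R1 where "R1 = (\<lambda>p q. \<Sum>k<a. \<Sum>l<a.
    R (k, snd p) (l, snd q) * E (unit_matrix a k l) $$ (fst p, fst q))"
  define R2 where "R2 = (\<lambda>p q. R1 (prod.swap p) (prod.swap q))"
  define R3 where "R3 = (\<lambda>p q. \<Sum>k<b. \<Sum>l<b.
    R2 (k, snd p) (l, snd q) * F (unit_matrix b k l) $$ (fst p, fst q))"
  have "psd_on ({..<a} \<times> {..<b}) R" using \<rho> by (simp add: psd_iff_entry2 R_def)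
  then have "psd_on ({..<d1} \<times> {..<b}) R1"
    unfolding R1_def using E by (intro completely_positive_psd_on) (auto simp: quantum_channel_def)
  then have "psd_on ({..<b} \<times> {..<d1}) R2"
    unfolding R2_def by (rule psd_on_swap)
  then have "psd_on ({..<d2} \<times> {..<d1}) R3"
    unfolding R3_def using F by (intro completely_positive_psd_on) (auto simp: quantum_channel_def)
  then have "psd_on ({..<d1} \<times> {..<d2}) (\<lambda>p q. R3 (prod.swap p) (prod.swap q))"
    by (rule psd_on_swap)
  moreover have "R3 (prod.swap p) (prod.swap q) = entry2 d2 (tensor_map a d1 b d2 E F \<rho>) p q"
    if pq: "p \<in> {..<d1} \<times> {..<d2}" "q \<in> {..<d1} \<times> {..<d2}" for p q
  proof -
    obtain i i' j j' where eqs: "p = (i, i')" "q = (j, j')"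
      and lt: "i < d1" "i' < d2" "j < d1" "j' < d2" using pq by auto
    show ?thesis
      unfolding eqs
      by (subst entry2_tensor_map_channels)
        (use E F lt in \<open>simp_all add: quantum_channel_def sum_swap_pairs[of _ "{..<b}"] R3_def R2_def R1_def R_def
          sum_distrib_right mult.assoc\<close>)
  qed
  ultimately have "psd_on ({..<d1} \<times> {..<d2}) (entry2 d2 (tensor_map a d1 b d2 E F \<rho>))"
    using psd_on_cong by (metis (no_types, lifting))
  then show ?thesis by (simp add: psd_iff_entry2)
qed

lemma channel_unit_trace:
  assumes "quantum_channel a b E" "k < a"
  shows "(\<Sum>i<b. E (unit_matrix a k l) $$ (i, i)) = (if k = l then 1 else 0)"
proof -
  have "E (unit_matrix a k l) \<in> carrier_mat b b"
    using assms by (auto simp: quantum_channel_def linear_map_mat_def)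
  then have "(\<Sum>i<b. E (unit_matrix a k l) $$ (i, i)) = mat_trace (E (unit_matrix a k l))"
    by (simp add: mat_trace_carrier)
  also have "\<dots> = mat_trace (unit_matrix a k l)"
    using assms by (simp add: quantum_channel_def)
  finally show ?thesis using mat_trace_unit_matrix[OF assms(2)] by simp
qed

text \<open>No-signalling: the right-hand side does not mention \<open>E\<close>. Trace preservation
  on the matrix units, off-diagonal ones included, leaves only the terms with
  \<open>l = k\<close>.\<close>

lemma tensor_map_partial_trace_left:
  assumes E: "quantum_channel a d1 E" and F: "quantum_channel b d2 F" and "m < d2" "n < d2"
  shows "(\<Sum>i<d1. entry2 d2 (tensor_map a d1 b d2 E F \<rho>) (i, m) (i, n)) =
    (\<Sum>k<a. \<Sum>k'<b. \<Sum>l'<b. entry2 b \<rho> (k, k') (k, l') * F (unit_matrix b k' l') $$ (m, n))"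
proof -
  have "(\<Sum>i<d1. entry2 d2 (tensor_map a d1 b d2 E F \<rho>) (i, m) (i, n)) =
    (\<Sum>i<d1. \<Sum>k<a. \<Sum>l<a. \<Sum>k'<b. \<Sum>l'<b. entry2 b \<rho> (k, k') (l, l') *
      (E (unit_matrix a k l) $$ (i, i) * F (unit_matrix b k' l') $$ (m, n)))"
    by (intro sum.cong refl entry2_tensor_map_channels) (use assms in \<open>auto simp: quantum_channel_def\<close>)
  also have "\<dots> = (\<Sum>k<a. \<Sum>l<a. \<Sum>k'<b. \<Sum>l'<b. entry2 b \<rho> (k, k') (l, l') *
      ((\<Sum>i<d1. E (unit_matrix a k l) $$ (i, i)) * F (unit_matrix b k' l') $$ (m, n)))"
    by (simp add: sum.swap[of _ _ "{..<d1}"] sum_distrib_left sum_distrib_right)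
  also have "\<dots> = (\<Sum>k<a. \<Sum>l<a. if l = k then (\<Sum>k'<b. \<Sum>l'<b. entry2 b \<rho> (k, k') (k, l') *
      F (unit_matrix b k' l') $$ (m, n)) else 0)"
    by (intro sum.cong refl) (auto simp: channel_unit_trace[OF E])
  finally show ?thesis by simp
qed

lemma tensor_map_partial_trace_right:
  assumes E: "quantum_channel a d1 E" and F: "quantum_channel b d2 F" and "i < d1" "j < d1"
  shows "(\<Sum>m<d2. entry2 d2 (tensor_map a d1 b d2 E F \<rho>) (i, m) (j, m)) =
    (\<Sum>k<a. \<Sum>l<a. \<Sum>k'<b. entry2 b \<rho> (k, k') (l, k') * E (unit_matrix a k l) $$ (i, j))"
proof -
  have "(\<Sum>m<d2. entry2 d2 (tensor_map a d1 b d2 E F \<rho>) (i, m) (j, m)) =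
    (\<Sum>m<d2. \<Sum>k<a. \<Sum>l<a. \<Sum>k'<b. \<Sum>l'<b. entry2 b \<rho> (k, k') (l, l') *
      (E (unit_matrix a k l) $$ (i, j) * F (unit_matrix b k' l') $$ (m, m)))"
    by (intro sum.cong refl entry2_tensor_map_channels) (use assms in \<open>auto simp: quantum_channel_def\<close>)
  also have "\<dots> = (\<Sum>k<a. \<Sum>l<a. \<Sum>k'<b. \<Sum>l'<b. entry2 b \<rho> (k, k') (l, l') *
      (E (unit_matrix a k l) $$ (i, j) * (\<Sum>m<d2. F (unit_matrix b k' l') $$ (m, m))))"
    by (simp add: sum.swap[of _ _ "{..<d2}"] sum_distrib_left sum_distrib_right)
  also have "\<dots> = (\<Sum>k<a. \<Sum>l<a. \<Sum>k'<b. \<Sum>l'<b. if l' = k' then entry2 b \<rho> (k, k') (l, k') *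
      E (unit_matrix a k l) $$ (i, j) else 0)"
    by (intro sum.cong refl) (auto simp: channel_unit_trace[OF F])
  finally show ?thesis by simp
qed

lemma tensor_map_trace:
  assumes E: "quantum_channel a d1 E" and F: "quantum_channel b d2 F"
    and \<rho>: "\<rho> \<in> carrier_mat (a * b) (a * b)"
  shows "(\<Sum>m<d2. \<Sum>i<d1. entry2 d2 (tensor_map a d1 b d2 E F \<rho>) (i, m) (i, m)) = mat_trace \<rho>"
proof -
  have "(\<Sum>m<d2. \<Sum>i<d1. entry2 d2 (tensor_map a d1 b d2 E F \<rho>) (i, m) (i, m)) =
    (\<Sum>m<d2. \<Sum>k<a. \<Sum>k'<b. \<Sum>l'<b. entry2 b \<rho> (k, k') (k, l') * F (unit_matrix b k' l') $$ (m, m))"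
    by (intro sum.cong refl tensor_map_partial_trace_left[OF E F]) auto
  also have "\<dots> = (\<Sum>k<a. \<Sum>k'<b. \<Sum>l'<b. entry2 b \<rho> (k, k') (k, l') * (\<Sum>m<d2. F (unit_matrix b k' l') $$ (m, m)))"
    by (simp add: sum.swap[of _ _ "{..<d2}"] sum_distrib_left)
  also have "\<dots> = (\<Sum>k<a. \<Sum>k'<b. \<Sum>l'<b. if l' = k' then entry2 b \<rho> (k, k') (k, k') else 0)"
    by (intro sum.cong refl) (auto simp: channel_unit_trace[OF F])
  also have "\<dots> = mat_trace \<rho>"
    using \<rho> by (simp add: mat_trace_carrier sum_pair_index entry2_def pair_index_def)
  finally show ?thesis .
qed

section \<open>Entangled strategies\<close>

lemma entry2_eq_one:
  assumes "p \<in> {..<a} \<times> {..<b}" "q \<in> {..<a} \<times> {..<b}"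
  shows "entry2 b (1\<^sub>m (a * b)) p q = (if p = q then 1 else 0)"
proof -
  have "pair_index b p < a * b" "pair_index b q < a * b"
    using assms by (auto simp: pair_index_def pair_index_less)
  then have "entry2 b (1\<^sub>m (a * b)) p q = (if pair_index b p = pair_index b q then 1 else 0)"
    by (simp add: entry2_def)
  then show ?thesis
    using inj_on_eq_iff[OF bij_betw_imp_inj_on[OF bij_betw_pair_index] assms] by simp
qed

lemma povm_entry2_sum:
  assumes "povm Zs (a * b) P" "p \<in> {..<a} \<times> {..<b}" "q \<in> {..<a} \<times> {..<b}"
  shows "(\<Sum>z\<in>Zs. entry2 b (P z) p q) = (if p = q then 1 else 0)"
proof -
  have "pair_index b p < a * b" "pair_index b q < a * b"
    using assms(2,3) by (auto simp: pair_index_def pair_index_less)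
  then have "(\<Sum>z\<in>Zs. entry2 b (P z) p q) =
    entry2 b (mat (a * b) (a * b) (\<lambda>ij. \<Sum>z\<in>Zs. P z $$ ij)) p q"
    by (simp add: entry2_def)
  also have "\<dots> = entry2 b (1\<^sub>m (a * b)) p q"
    using assms(1) by (simp add: povm_def)
  finally show ?thesis using entry2_eq_one[OF assms(2,3)] by simp
qed

lemma povm_psd_on:
  "povm Zs (a * b) P \<Longrightarrow> z \<in> Zs \<Longrightarrow> psd_on ({..<a} \<times> {..<b}) (entry2 b (P z))"
  by (auto simp: povm_def psd_iff_entry2)

text \<open>Transports the trace formula to exchanged tensor factors, so that the bound for the
  first factor can also be used for the second.\<close>

lemma sum_swap_Times:
  "(\<Sum>p\<in>A \<times> B. \<Sum>q\<in>A \<times> B. f p q) =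
   (\<Sum>p\<in>B \<times> A. \<Sum>q\<in>B \<times> A. f (prod.swap p) (prod.swap q))"
proof -
  have single: "(\<Sum>p\<in>A \<times> B. g p) = (\<Sum>p\<in>B \<times> A. g (prod.swap p))" for g
    unfolding sum_Times swap_simp by (rule sum.swap)
  show ?thesis
    by (subst single, intro sum.cong refl, subst single) (rule refl)
qed

context
  fixes Xs :: "'x set" and Ys :: "'y set" and Zs :: "'z set" and d1 d2 a b \<rho> E F P
  assumes strategy: "assisted_strategy Xs Ys Zs d1 d2 a b \<rho> E F P"
begin

lemma strategy_povm: "povm Zs (d1 * d2) P"
  using strategy by (simp add: assisted_strategy_def)

lemma strategy_output_psd_on:
  "x \<in> Xs \<Longrightarrow> y \<in> Ys \<Longrightarrow> psd_on ({..<d1} \<times> {..<d2}) (entry2 d2 (tensor_map a d1 b d2 (E x) (F y) \<rho>))"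
  using strategy psd_tensor_map[of a d1 "E x" b d2 "F y" \<rho>]
  by (simp add: assisted_strategy_def density_operator_def psd_iff_entry2)

lemma outcome_prob_pairs:
  assumes "z \<in> Zs"
  shows "outcome_prob d1 d2 a b \<rho> E F P z x y =
    (\<Sum>p\<in>{..<d1} \<times> {..<d2}. \<Sum>q\<in>{..<d1} \<times> {..<d2}.
      entry2 d2 (P z) p q * entry2 d2 (tensor_map a d1 b d2 (E x) (F y) \<rho>) q p)"
  unfolding outcome_prob_def
  by (rule mat_trace_mult_pairs) (use strategy assms in \<open>auto simp: assisted_strategy_def povm_def psd_def\<close>)

lemma outcome_prob_nonneg:
  assumes "x \<in> Xs" "y \<in> Ys" "z \<in> Zs"
  shows "0 \<le> outcome_prob d1 d2 a b \<rho> E F P z x y"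
  unfolding outcome_prob_pairs[OF assms(3)]
  by (intro psd_on_trace_mult_nonneg strategy_output_psd_on povm_psd_on[OF strategy_povm])
    (use assms in auto)

lemma outcome_prob_sum:
  assumes "x \<in> Xs" "y \<in> Ys"
  shows "(\<Sum>z\<in>Zs. outcome_prob d1 d2 a b \<rho> E F P z x y) = 1"
proof -
  let ?IJ = "{..<d1} \<times> {..<d2}" and ?T = "entry2 d2 (tensor_map a d1 b d2 (E x) (F y) \<rho>)"
  have "(\<Sum>z\<in>Zs. outcome_prob d1 d2 a b \<rho> E F P z x y) =
    (\<Sum>p\<in>?IJ. \<Sum>q\<in>?IJ. (\<Sum>z\<in>Zs. entry2 d2 (P z) p q) * ?T q p)"
  proof -
    have "(\<Sum>z\<in>Zs. outcome_prob d1 d2 a b \<rho> E F P z x y) =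
      (\<Sum>z\<in>Zs. \<Sum>p\<in>?IJ. \<Sum>q\<in>?IJ. entry2 d2 (P z) p q * ?T q p)"
      by (intro sum.cong refl outcome_prob_pairs)
    also have "\<dots> = (\<Sum>p\<in>?IJ. \<Sum>z\<in>Zs. \<Sum>q\<in>?IJ. entry2 d2 (P z) p q * ?T q p)"
      by (rule sum.swap)
    also have "\<dots> = (\<Sum>p\<in>?IJ. \<Sum>q\<in>?IJ. \<Sum>z\<in>Zs. entry2 d2 (P z) p q * ?T q p)"
      by (intro sum.cong refl sum.swap)
    finally show ?thesis by (simp add: sum_distrib_right)
  qed
  also have "\<dots> = (\<Sum>p\<in>?IJ. \<Sum>q\<in>?IJ. if p = q then ?T q p else 0)"
    by (intro sum.cong refl) (subst povm_entry2_sum[OF strategy_povm], simp_all)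
  also have "\<dots> = (\<Sum>p\<in>?IJ. ?T p p)" by simp
  also have "\<dots> = (\<Sum>m<d2. \<Sum>i<d1. ?T (i, m) (i, m))"
    unfolding sum_Times by (rule sum.swap)
  also have "\<dots> = 1"
    using strategy assms
    by (subst tensor_map_trace) (auto simp: assisted_strategy_def density_operator_def psd_def)
  finally show ?thesis .
qed

lemma outcome_prob_le_1:
  assumes "x \<in> Xs" "y \<in> Ys" "z \<in> Zs" "finite Zs"
  shows "outcome_prob d1 d2 a b \<rho> E F P z x y \<le> 1"
  using member_le_sum[of z Zs "\<lambda>z. outcome_prob d1 d2 a b \<rho> E F P z x y"]
    outcome_prob_nonneg[OF assms(1,2)] outcome_prob_sum[OF assms(1,2)] assms(3,4) by simp

lemma outcome_prob_sum_left_le: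
  assumes "y \<in> Ys" "finite Zs" "inj_on g Xs" "g ` Xs \<subseteq> Zs"
  shows "(\<Sum>x\<in>Xs. outcome_prob d1 d2 a b \<rho> E F P (g x) x y) \<le> of_nat (d1\<^sup>2)"
proof -
  let ?T = "\<lambda>x. entry2 d2 (tensor_map a d1 b d2 (E x) (F y) \<rho>)"
  \<comment> \<open>The reduced output on the second system, in a closed form that contains
    \<open>F y\<close> but no input of Sender 1.\<close>
  define B where "B = (\<lambda>m n. \<Sum>k<a. \<Sum>k'<b. \<Sum>l'<b. entry2 b \<rho> (k, k') (k, l') * F y (unit_matrix b k' l') $$ (m, n))"
  show ?thesis
  proof (cases "Xs = {}")
    case True
    then show ?thesis by (simp add: less_eq_complex_def)
  next
    case False
    then obtain x0 where x0: "x0 \<in> Xs" by blast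
    have ch: "quantum_channel a d1 (E x)" "quantum_channel b d2 (F y)" if "x \<in> Xs" for x
      using strategy assms(1) that by (auto simp: assisted_strategy_def)
    have B: "(\<Sum>i<d1. ?T x (i, m) (i, n)) = B m n" if "x \<in> Xs" "m \<in> {..<d2}" "n \<in> {..<d2}" for x m n
      unfolding B_def by (rule tensor_map_partial_trace_left) (use ch that in auto)
    have trB: "(\<Sum>m<d2. B m m) = 1"
    proof -
      have "(\<Sum>m<d2. B m m) = (\<Sum>m<d2. \<Sum>i<d1. ?T x0 (i, m) (i, m))"
        by (intro sum.cong refl B[OF x0, symmetric]) auto
      also have "\<dots> = 1"
        using strategy ch x0
        by (subst tensor_map_trace) (auto simp: assisted_strategy_def density_operator_def psd_def)
      finally show ?thesis .
    qed
    have "(\<Sum>x\<in>Xs. outcome_prob d1 d2 a b \<rho> E F P (g x) x y) =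
      (\<Sum>x\<in>Xs. \<Sum>p\<in>{..<d1} \<times> {..<d2}. \<Sum>q\<in>{..<d1} \<times> {..<d2}. entry2 d2 (P (g x)) p q * ?T x q p)"
      using assms(4) by (intro sum.cong refl outcome_prob_pairs) auto
    also have "\<dots> \<le> of_nat ((card {..<d1})\<^sup>2)"
      by (intro superdense_bound[where Zs = Zs and B = B] B trB povm_psd_on[OF strategy_povm]
        povm_entry2_sum[OF strategy_povm] strategy_output_psd_on) (use assms in auto)
    finally show ?thesis by simp
  qed
qed

text \<open>The superdense bound refers to the first tensor factor, so it is applied to the kernels
  with exchanged factors; the common marginal is now the one on the first system, fixed by
  \<open>E x\<close>.\<close>

lemma outcome_prob_sum_right_le:
  assumes "x \<in> Xs" "finite Zs" "inj_on g Ys" "g ` Ys \<subseteq> Zs"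
  shows "(\<Sum>y\<in>Ys. outcome_prob d1 d2 a b \<rho> E F P (g y) x y) \<le> of_nat (d2\<^sup>2)"
proof -
  let ?T = "\<lambda>y. entry2 d2 (tensor_map a d1 b d2 (E x) (F y) \<rho>)"
  define B where "B = (\<lambda>i j. \<Sum>k<a. \<Sum>l<a. \<Sum>k'<b. entry2 b \<rho> (k, k') (l, k') * E x (unit_matrix a k l) $$ (i, j))"
  show ?thesis
  proof (cases "Ys = {}")
    case True
    then show ?thesis by (simp add: less_eq_complex_def)
  next
    case False
    then obtain y0 where y0: "y0 \<in> Ys" by blast
    have ch: "quantum_channel a d1 (E x)" "quantum_channel b d2 (F y)" if "y \<in> Ys" for y
      using strategy assms(1) that by (auto simp: assisted_strategy_def)
    have B: "(\<Sum>m<d2. ?T y (prod.swap (m, i)) (prod.swap (m, j))) = B i j"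
      if "y \<in> Ys" "i \<in> {..<d1}" "j \<in> {..<d1}" for y i j
      unfolding B_def prod.swap_def fst_conv snd_conv
      by (rule tensor_map_partial_trace_right) (use ch that in auto)
    have trB: "(\<Sum>i<d1. B i i) = 1"
    proof -
      have "(\<Sum>i<d1. B i i) = (\<Sum>i<d1. \<Sum>m<d2. ?T y0 (i, m) (i, m))"
        by (intro sum.cong refl) (simp flip: B[OF y0])
      also have "\<dots> = (\<Sum>m<d2. \<Sum>i<d1. ?T y0 (i, m) (i, m))"
        by (rule sum.swap)
      also have "\<dots> = 1"
        using strategy ch y0
        by (subst tensor_map_trace) (auto simp: assisted_strategy_def density_operator_def psd_def)
      finally show ?thesis .
    qed
    have P1: "(\<Sum>z\<in>Zs. entry2 d2 (P z) (prod.swap p) (prod.swap q)) = (if p = q then 1 else 0)"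
      if "p \<in> {..<d2} \<times> {..<d1}" "q \<in> {..<d2} \<times> {..<d1}" for p q
      using povm_entry2_sum[OF strategy_povm, of "prod.swap p" "prod.swap q"] that
      by (cases p; cases q) (simp add: conj_commute)
    have "(\<Sum>y\<in>Ys. outcome_prob d1 d2 a b \<rho> E F P (g y) x y) =
      (\<Sum>y\<in>Ys. \<Sum>p\<in>{..<d1} \<times> {..<d2}. \<Sum>q\<in>{..<d1} \<times> {..<d2}. entry2 d2 (P (g y)) p q * ?T y q p)"
      using assms(4) by (intro sum.cong refl outcome_prob_pairs) auto
    also have "\<dots> = (\<Sum>y\<in>Ys. \<Sum>p\<in>{..<d2} \<times> {..<d1}. \<Sum>q\<in>{..<d2} \<times> {..<d1}.
        entry2 d2 (P (g y)) (prod.swap p) (prod.swap q) * ?T y (prod.swap q) (prod.swap p))"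
      by (intro sum.cong refl sum_swap_Times)
    also have "\<dots> \<le> of_nat ((card {..<d2})\<^sup>2)"
      by (intro superdense_bound[where Zs = Zs and B = B
            and P = "\<lambda>z p q. entry2 d2 (P z) (prod.swap p) (prod.swap q)"
            and T = "\<lambda>y p q. ?T y (prod.swap p) (prod.swap q)"]
          B trB psd_on_swap povm_psd_on[OF strategy_povm] P1 strategy_output_psd_on) (use assms in auto)
    finally show ?thesis by simp
  qed
qed

text \<open>Members of \<open>QE\<close> are real-valued. Nonnegativity in the complex order means
  that the imaginary part is zero, hence \<open>Re\<close> loses nothing on the alphabets.\<close>

lemma strategy_in_QE:
  "(\<lambda>z x y. Re (outcome_prob d1 d2 a b \<rho> E F P z x y)) \<in> QE Xs Ys Zs d1 d2"
proof -
  have "complex_of_real (Re (outcome_prob d1 d2 a b \<rho> E F P z x y)) = outcome_prob d1 d2 a b \<rho> E F P z x y"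
    if "z \<in> Zs" "x \<in> Xs" "y \<in> Ys" for z x y
    using outcome_prob_nonneg[OF that(2,3,1)] by (simp add: less_eq_complex_def complex_eq_iff)
  with strategy show ?thesis unfolding QE_def by blast
qed

end

lemma QE_E:
  assumes "Q \<in> QE Xs Ys Zs d1 d2"
  obtains a b \<rho> E F P where "assisted_strategy Xs Ys Zs d1 d2 a b \<rho> E F P"
    "\<forall>z\<in>Zs. \<forall>x\<in>Xs. \<forall>y\<in>Ys. complex_of_real (Q z x y) = outcome_prob d1 d2 a b \<rho> E F P z x y"
  using assms unfolding QE_def mem_Collect_eq by (elim exE conjE)

lemma QE_le_1:
  assumes "Q \<in> QE Xs Ys Zs d1 d2" "finite Zs" "x \<in> Xs" "y \<in> Ys" "z \<in> Zs"
  shows "Q z x y \<le> 1"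
proof -
  from assms(1) obtain a b \<rho> E F P where s: "assisted_strategy Xs Ys Zs d1 d2 a b \<rho> E F P"
    and Q: "\<forall>z\<in>Zs. \<forall>x\<in>Xs. \<forall>y\<in>Ys. complex_of_real (Q z x y) = outcome_prob d1 d2 a b \<rho> E F P z x y"
    by (rule QE_E)
  have "complex_of_real (Q z x y) \<le> 1"
    using outcome_prob_le_1[OF s] Q assms by simp
  then show ?thesis by (simp add: less_eq_complex_def)
qed

lemma QE_sum_left_le:
  assumes "Q \<in> QE Xs Ys Zs d1 d2" "finite Zs" "y \<in> Ys" "inj_on g Xs" "g ` Xs \<subseteq> Zs"
  shows "(\<Sum>x\<in>Xs. Q (g x) x y) \<le> (real d1)\<^sup>2"
proof -
  from assms(1) obtain a b \<rho> E F P where s: "assisted_strategy Xs Ys Zs d1 d2 a b \<rho> E F P"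
    and Q: "\<forall>z\<in>Zs. \<forall>x\<in>Xs. \<forall>y\<in>Ys. complex_of_real (Q z x y) = outcome_prob d1 d2 a b \<rho> E F P z x y"
    by (rule QE_E)
  have "complex_of_real (\<Sum>x\<in>Xs. Q (g x) x y) = (\<Sum>x\<in>Xs. outcome_prob d1 d2 a b \<rho> E F P (g x) x y)"
    unfolding of_real_sum using Q assms by (intro sum.cong) auto
  also have "\<dots> \<le> of_nat (d1\<^sup>2)"
    by (rule outcome_prob_sum_left_le[OF s assms(3,2,4,5)])
  finally have "complex_of_real (\<Sum>x\<in>Xs. Q (g x) x y) \<le> of_real ((real d1)\<^sup>2)" by simp
  then show ?thesis unfolding less_eq_complex_def by (simp del: of_real_sum of_real_power)
qed

lemma QE_sum_right_le:
  assumes "Q \<in> QE Xs Ys Zs d1 d2" "finite Zs" "x \<in> Xs" "inj_on g Ys" "g ` Ys \<subseteq> Zs"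
  shows "(\<Sum>y\<in>Ys. Q (g y) x y) \<le> (real d2)\<^sup>2"
proof -
  from assms(1) obtain a b \<rho> E F P where s: "assisted_strategy Xs Ys Zs d1 d2 a b \<rho> E F P"
    and Q: "\<forall>z\<in>Zs. \<forall>x\<in>Xs. \<forall>y\<in>Ys. complex_of_real (Q z x y) = outcome_prob d1 d2 a b \<rho> E F P z x y"
    by (rule QE_E)
  have "complex_of_real (\<Sum>y\<in>Ys. Q (g y) x y) = (\<Sum>y\<in>Ys. outcome_prob d1 d2 a b \<rho> E F P (g y) x y)"
    unfolding of_real_sum using Q assms by (intro sum.cong) auto
  also have "\<dots> \<le> of_nat (d2\<^sup>2)"
    by (rule outcome_prob_sum_right_le[OF s assms(3,2,4,5)])
  finally have "complex_of_real (\<Sum>y\<in>Ys. Q (g y) x y) \<le> of_real ((real d2)\<^sup>2)" by simp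
  then show ?thesis unfolding less_eq_complex_def by (simp del: of_real_sum of_real_power)
qed

section \<open>Unitary conjugations and Weyl operators\<close>

text \<open>The form is a sum of squared moduli of inner products with the vectors
  \<open>g c\<close>; this is the converse of the rank-one decomposition.\<close>

lemma psd_on_gram: "psd_on S (\<lambda>p q. \<Sum>c\<in>C. g c p * cnj (g c q))"
proof (rule psd_onI)
  fix v
  have "(\<Sum>p\<in>S. \<Sum>q\<in>S. (\<Sum>c\<in>C. g c p * cnj (g c q)) * v q * cnj (v p)) =
    (\<Sum>p\<in>S. \<Sum>q\<in>S. \<Sum>c\<in>C. (g c p * cnj (v p)) * (cnj (g c q) * v q))"
    by (simp add: sum_distrib_left sum_distrib_right mult_ac)
  also have "\<dots> = (\<Sum>p\<in>S. \<Sum>c\<in>C. \<Sum>q\<in>S. (g c p * cnj (v p)) * (cnj (g c q) * v q))"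
    by (intro sum.cong refl sum.swap)
  also have "\<dots> = (\<Sum>c\<in>C. \<Sum>p\<in>S. \<Sum>q\<in>S. (g c p * cnj (v p)) * (cnj (g c q) * v q))"
    by (rule sum.swap)
  also have "\<dots> = (\<Sum>c\<in>C. (\<Sum>p\<in>S. g c p * cnj (v p)) * cnj (\<Sum>p\<in>S. g c p * cnj (v p)))"
    by (simp add: sum_product)
  also have "0 \<le> \<dots>"
    by (intro sum_nonneg) (simp only: complex_norm_square[symmetric], simp add: less_eq_complex_def)
  finally show "0 \<le> (\<Sum>p\<in>S. \<Sum>q\<in>S. (\<Sum>c\<in>C. g c p * cnj (g c q)) * v q * cnj (v p))" .
qed

lemma mat_adjoint_carrier: "U \<in> carrier_mat a a \<Longrightarrow> mat_adjoint U \<in> carrier_mat a a"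
  by (auto simp: mat_adjoint_def)

lemma mat_adjoint_index:
  "U \<in> carrier_mat a a \<Longrightarrow> i < a \<Longrightarrow> j < a \<Longrightarrow> mat_adjoint U $$ (i, j) = cnj (U $$ (j, i))"
  by (auto simp: mat_adjoint_def mat_of_rows_def)

lemma conjugation_map_index:
  assumes "U \<in> carrier_mat a a" "M \<in> carrier_mat a a" "i < a" "j < a"
  shows "conjugation_map U M $$ (i, j) = (\<Sum>k<a. \<Sum>l<a. M $$ (k, l) * (U $$ (i, k) * cnj (U $$ (j, l))))"
proof -
  have "conjugation_map U M $$ (i, j) = (\<Sum>k<a. U $$ (i, k) * (\<Sum>l<a. M $$ (k, l) * cnj (U $$ (j, l))))"
    using assms mat_adjoint_carrier[OF assms(1)] mat_adjoint_index[OF assms(1)]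
    by (simp add: conjugation_map_def scalar_prod_def atLeast0LessThan)
  then show ?thesis by (simp add: sum_distrib_left mult_ac)
qed

lemma conjugation_map_carrier:
  "U \<in> carrier_mat a a \<Longrightarrow> M \<in> carrier_mat a a \<Longrightarrow> conjugation_map U M \<in> carrier_mat a a"
  using mat_adjoint_carrier[of U a] by (auto simp: conjugation_map_def)

lemma conjugation_map_unit_matrix:
  assumes "U \<in> carrier_mat a a" "k < a" "l < a" "i < a" "j < a"
  shows "conjugation_map U (unit_matrix a k l) $$ (i, j) = U $$ (i, k) * cnj (U $$ (j, l))"
proof -
  have "conjugation_map U (unit_matrix a k l) $$ (i, j) =
    (\<Sum>k'<a. \<Sum>l'<a. if l' = l then if k' = k then U $$ (i, k) * cnj (U $$ (j, l)) else 0 else 0)"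
    unfolding conjugation_map_index[OF assms(1) unit_matrix_carrier assms(4,5)]
    by (intro sum.cong refl) (auto simp: unit_matrix_def)
  then show ?thesis using assms(2,3) by simp
qed

lemma conjugation_map_linear:
  assumes U: "U \<in> carrier_mat a a"
  shows "linear_map_mat a a (conjugation_map U)"
proof -
  note A = mat_adjoint_carrier[OF U]
  have add: "conjugation_map U (M + N) = conjugation_map U M + conjugation_map U N"
    if "M \<in> carrier_mat a a" "N \<in> carrier_mat a a" for M N
    using U A that
    by (simp add: conjugation_map_def mult_add_distrib_mat[of U a a] add_mult_distrib_mat[of "U * M" a a])
  have smult: "conjugation_map U (c \<cdot>\<^sub>m M) = c \<cdot>\<^sub>m conjugation_map U M" if "M \<in> carrier_mat a a" for c M
    using U A that
    by (simp add: conjugation_map_def mult_smult_distrib[of U a a] mult_smult_assoc_mat[of "U * M" a a])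
  show ?thesis
    unfolding linear_map_mat_def using conjugation_map_carrier[OF U] add smult by blast
qed

lemma conjugation_map_completely_positive:
  assumes U: "U \<in> carrier_mat a a"
  shows "completely_positive a a (conjugation_map U)"
  unfolding completely_positive_def
proof (intro allI impI)
  fix n M
  assume M: "psd (a * n) M"
  let ?S = "{..<a} \<times> {..<n}"
  obtain w where w: "\<forall>p\<in>?S. \<forall>q\<in>?S. entry2 n M p q = (\<Sum>c\<in>?S. w c p * cnj (w c q))"
    using psd_on_decomposition[of ?S "entry2 n M"] M by (auto simp: psd_iff_entry2)
  \<comment> \<open>The vector obtained from \<open>w c\<close> by letting \<open>U\<close> act on
    the first factor. Each rank-one term of \<open>M\<close> goes to the rank-one term of
    \<open>g c\<close>, so the output is again a Gram kernel.\<close>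
  define g where "g = (\<lambda>c p. \<Sum>k<a. U $$ (fst p, k) * w c (k, snd p))"
  have "entry2 n (tensor_map a a n n (conjugation_map U) (\<lambda>N. N) M) p q = (\<Sum>c\<in>?S. g c p * cnj (g c q))"
    if pq: "p \<in> ?S" "q \<in> ?S" for p q
  proof -
    obtain i i' j j' where eqs: "p = (i, i')" "q = (j, j')"
      and lt: "i < a" "i' < n" "j < a" "j' < n" using pq by auto
    have "entry2 n (tensor_map a a n n (conjugation_map U) (\<lambda>N. N) M) p q =
      (\<Sum>k<a. \<Sum>l<a. \<Sum>k'<n. \<Sum>l'<n. entry2 n M (k, k') (l, l') *
        (conjugation_map U (unit_matrix a k l) $$ (i, j) * unit_matrix n k' l' $$ (i', j')))"
      unfolding eqs
      by (rule entry2_tensor_map) (use lt conjugation_map_carrier[OF U] in auto)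
    also have "\<dots> = (\<Sum>k<a. \<Sum>l<a. \<Sum>k'<n. \<Sum>l'<n. if l' = j' then if k' = i' then
        entry2 n M (k, i') (l, j') * (U $$ (i, k) * cnj (U $$ (j, l))) else 0 else 0)"
      using lt conjugation_map_unit_matrix[OF U] by (intro sum.cong refl) (auto simp: unit_matrix_def)
    also have "\<dots> = (\<Sum>k<a. \<Sum>l<a. entry2 n M (k, i') (l, j') * (U $$ (i, k) * cnj (U $$ (j, l))))"
      using lt by simp
    also have "\<dots> = (\<Sum>k<a. \<Sum>l<a. \<Sum>c\<in>?S. (U $$ (i, k) * w c (k, i')) * (cnj (U $$ (j, l)) * cnj (w c (l, j'))))"
      using w lt by (intro sum.cong refl) (simp add: sum_distrib_left sum_distrib_right mult_ac)
    also have "\<dots> = (\<Sum>k<a. \<Sum>c\<in>?S. \<Sum>l<a. (U $$ (i, k) * w c (k, i')) * (cnj (U $$ (j, l)) * cnj (w c (l, j'))))"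
      by (intro sum.cong refl sum.swap)
    also have "\<dots> = (\<Sum>c\<in>?S. \<Sum>k<a. \<Sum>l<a. (U $$ (i, k) * w c (k, i')) * (cnj (U $$ (j, l)) * cnj (w c (l, j'))))"
      by (rule sum.swap)
    also have "\<dots> = (\<Sum>c\<in>?S. g c p * cnj (g c q))"
      by (simp add: g_def eqs sum_product)
    finally show ?thesis .
  qed
  then have "psd_on ?S (entry2 n (tensor_map a a n n (conjugation_map U) (\<lambda>N. N) M)) \<longleftrightarrow>
    psd_on ?S (\<lambda>p q. \<Sum>c\<in>?S. g c p * cnj (g c q))"
    by (rule psd_on_cong)
  with psd_on_gram[of ?S g ?S] show "psd (a * n) (tensor_map a a n n (conjugation_map U) (\<lambda>N. N) M)"
    by (simp add: psd_iff_entry2)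
qed

text \<open>The hypothesis \<open>iso\<close> is orthonormality of the columns of \<open>U\<close>,
  which is what trace preservation uses; positivity holds for conjugation by any matrix.\<close>

lemma conjugation_map_channel:
  assumes U: "U \<in> carrier_mat a a"
    and iso: "\<And>k l. k < a \<Longrightarrow> l < a \<Longrightarrow> (\<Sum>i<a. U $$ (i, k) * cnj (U $$ (i, l))) = (if k = l then 1 else 0)"
  shows "quantum_channel a a (conjugation_map U)"
proof -
  have "mat_trace (conjugation_map U M) = mat_trace M" if M: "M \<in> carrier_mat a a" for M
  proof -
    have "mat_trace (conjugation_map U M) =
      (\<Sum>i<a. \<Sum>k<a. \<Sum>l<a. M $$ (k, l) * (U $$ (i, k) * cnj (U $$ (i, l))))"
      by (simp add: mat_trace_carrier[OF conjugation_map_carrier[OF U M]] conjugation_map_index[OF U M])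
    also have "\<dots> = (\<Sum>k<a. \<Sum>i<a. \<Sum>l<a. M $$ (k, l) * (U $$ (i, k) * cnj (U $$ (i, l))))"
      by (rule sum.swap)
    also have "\<dots> = (\<Sum>k<a. \<Sum>l<a. \<Sum>i<a. M $$ (k, l) * (U $$ (i, k) * cnj (U $$ (i, l))))"
      by (intro sum.cong refl sum.swap)
    also have "\<dots> = (\<Sum>k<a. \<Sum>l<a. if l = k then M $$ (k, k) else 0)"
      by (intro sum.cong refl) (auto simp: iso simp flip: sum_distrib_left)
    also have "\<dots> = mat_trace M" by (simp add: mat_trace_carrier[OF M])
    finally show ?thesis .
  qed
  then show ?thesis
    unfolding quantum_channel_def
    using conjugation_map_linear[OF U] conjugation_map_completely_positive[OF U] by blast
qed

lemma psd_ketbra: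
  assumes "v \<in> carrier_vec m"
  shows "psd m (ketbra v)"
proof -
  have "psd_on {..<m} (\<lambda>i j. ketbra v $$ (i, j)) \<longleftrightarrow>
    psd_on {..<m} (\<lambda>i j. \<Sum>c\<in>{()}. (\<lambda>c i. v $ i) c i * cnj ((\<lambda>c i. v $ i) c j))"
    by (rule psd_on_cong) (use assms in \<open>auto simp: ketbra_def\<close>)
  then show ?thesis
    using assms psd_on_gram[of "{..<m}" "\<lambda>c i. v $ i" "{()}"]
    by (auto simp: psd_iff_psd_on ketbra_def)
qed

lemma entry2_ketbra:
  assumes "v \<in> carrier_vec (a * b)" "p \<in> {..<a} \<times> {..<b}" "q \<in> {..<a} \<times> {..<b}"
  shows "entry2 b (ketbra v) p q = v $ pair_index b p * cnj (v $ pair_index b q)"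
  using assms by (auto simp: entry2_def ketbra_def pair_index_def pair_index_less)

text \<open>Local conjugations keep a pure state pure: \<open>g\<close> lists the coordinates of
  \<open>U\<close> \<otimes> \<open>V\<close> applied to \<open>v\<close>. The protocol can thus be
  followed on vectors.\<close>

lemma tensor_map_conjugation_ketbra:
  assumes U: "U \<in> carrier_mat a a" and V: "V \<in> carrier_mat b b" and v: "v \<in> carrier_vec (a * b)"
    and lt: "i < a" "i' < b" "j < a" "j' < b"
  defines "g \<equiv> \<lambda>i i'. \<Sum>k<a. \<Sum>k'<b. v $ pair_index b (k, k') * (U $$ (i, k) * V $$ (i', k'))"
  shows "entry2 b (tensor_map a a b b (conjugation_map U) (conjugation_map V) (ketbra v)) (i, i') (j, j') =
    g i i' * cnj (g j j')"
proof -
  let ?f = "\<lambda>i i' k k'. v $ pair_index b (k, k') * (U $$ (i, k) * V $$ (i', k'))"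
  have "entry2 b (tensor_map a a b b (conjugation_map U) (conjugation_map V) (ketbra v)) (i, i') (j, j') =
    (\<Sum>k<a. \<Sum>l<a. \<Sum>k'<b. \<Sum>l'<b. entry2 b (ketbra v) (k, k') (l, l') *
        (conjugation_map U (unit_matrix a k l) $$ (i, j) * conjugation_map V (unit_matrix b k' l') $$ (i', j')))"
    by (rule entry2_tensor_map) (use lt conjugation_map_carrier U V in auto)
  also have "\<dots> = (\<Sum>k<a. \<Sum>l<a. \<Sum>k'<b. \<Sum>l'<b. ?f i i' k k' * cnj (?f j j' l l'))"
    using lt
    by (intro sum.cong refl)
      (simp add: entry2_ketbra[OF v] conjugation_map_unit_matrix[OF U] conjugation_map_unit_matrix[OF V])
  also have "\<dots> = (\<Sum>k<a. \<Sum>k'<b. \<Sum>l<a. \<Sum>l'<b. ?f i i' k k' * cnj (?f j j' l l'))"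
    by (intro sum.cong refl sum.swap)
  also have "\<dots> = (\<Sum>p\<in>{..<a} \<times> {..<b}. \<Sum>q\<in>{..<a} \<times> {..<b}.
      ?f i i' (fst p) (snd p) * cnj (?f j j' (fst q) (snd q)))"
    by (simp only: sum_Times fst_conv snd_conv)
  also have "\<dots> = (\<Sum>p\<in>{..<a} \<times> {..<b}. ?f i i' (fst p) (snd p)) *
      cnj (\<Sum>q\<in>{..<a} \<times> {..<b}. ?f j j' (fst q) (snd q))"
    unfolding cnj_sum by (rule sum_product[symmetric])
  also have "\<dots> = g i i' * cnj (g j j')"
    unfolding g_def by (simp only: sum_Times fst_conv snd_conv)
  finally show ?thesis .
qed

section \<open>Cyclic shifts and roots of unity\<close>

lemma bij_betw_mod_add:
  assumes "d > (0 :: nat)"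
  shows "bij_betw (\<lambda>i. (i + s) mod d) {..<d} {..<d}"
proof -
  have "inj_on (\<lambda>i. (i + s) mod d) {..<d}"
  proof (rule inj_onI)
    fix i j assume ij: "i \<in> {..<d}" "j \<in> {..<d}" "(i + s) mod d = (j + s) mod d"
    then obtain q q' where "i + s + d * q = j + s + d * q'" by (auto simp: nat_mod_eq_iff)
    then have "i mod d = j mod d" unfolding nat_mod_eq_iff by (intro exI[of _ q] exI[of _ q']) simp
    with ij show "i = j" by simp
  qed
  moreover have "(\<lambda>i. (i + s) mod d) ` {..<d} \<subseteq> {..<d}" using assms by auto
  ultimately show ?thesis by (simp add: bij_betw_def endo_inj_surj)
qed

lemma mod_add_eq_iff:
  assumes "i < d" "j < (d :: nat)"
  shows "(i + s) mod d = (j + s) mod d \<longleftrightarrow> i = j" "(s + i) mod d = (s + j) mod d \<longleftrightarrow> i = j"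
proof -
  show "(i + s) mod d = (j + s) mod d \<longleftrightarrow> i = j"
    using inj_on_eq_iff[OF bij_betw_imp_inj_on[OF bij_betw_mod_add[of d s]], of i j] assms by auto
  then show "(s + i) mod d = (s + j) mod d \<longleftrightarrow> i = j" by (simp add: add.commute)
qed

definition zeta :: "nat \<Rightarrow> complex" where
  "zeta d = exp (2 * of_real pi * \<i> / of_nat d)"

lemma zeta_cis: "zeta d = cis (2 * pi / d)"
  by (simp add: zeta_def cis_conv_exp mult_ac)

lemma zeta_cnj: "zeta d ^ k * cnj (zeta d ^ k) = 1" "cnj (zeta d ^ k) * zeta d ^ k = 1"
  by (simp_all add: zeta_cis DeMoivre cis_cnj cis_mult)

lemma zeta_root: "d > 0 \<Longrightarrow> zeta d ^ d = 1"
  by (simp add: zeta_cis DeMoivre)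

lemma zeta_mod: "d > 0 \<Longrightarrow> zeta d ^ (k mod d) = zeta d ^ k"
  using zeta_root[of d] by (metis div_mult_mod_eq mult.commute mult_1 power_add power_mult power_one)

lemma zeta_inj: "d > 0 \<Longrightarrow> k < d \<Longrightarrow> l < d \<Longrightarrow> zeta d ^ k = zeta d ^ l \<longleftrightarrow> k = l"
  using inj_on_eq_iff[OF bij_betw_imp_inj_on[OF bij_betw_roots_unity[of d]], of k l]
  by (simp add: zeta_cis DeMoivre mult_ac)

text \<open>For distinct \<open>k\<close> and \<open>l\<close> this is a geometric sum in a ratio
  \<open>x\<close> different from 1 with \<open>x ^ d = 1\<close>. It drives both the orthogonality
  and the completeness of the Bell vectors.\<close>

lemma zeta_orthogonal:
  assumes "d > 0" "k < d" "l < d"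
  shows "(\<Sum>m<d. zeta d ^ (k * m) * cnj (zeta d ^ (l * m))) = (if k = l then of_nat d else 0)"
proof (cases "k = l")
  case True
  then show ?thesis by (simp only: zeta_cnj) simp
next
  case False
  define x where "x = zeta d ^ k * cnj (zeta d ^ l)"
  have "x \<noteq> 1"
  proof
    assume "x = 1"
    then have "x * zeta d ^ l = zeta d ^ l" by simp
    then have "zeta d ^ k = zeta d ^ l" by (simp only: x_def mult.assoc zeta_cnj mult_1_right)
    with False assms show False by (simp add: zeta_inj)
  qed
  moreover have "x ^ d = 1"
  proof -
    have "x ^ d = (zeta d ^ d) ^ k * cnj ((zeta d ^ d) ^ l)"
      by (simp add: x_def power_mult_distrib flip: power_mult) (simp add: mult.commute)
    then show ?thesis by (simp add: zeta_root[OF assms(1)])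
  qed
  ultimately have "(\<Sum>m<d. x ^ m) = 0"
    using geometric_sum[of x d] by simp
  then show ?thesis using False by (simp add: x_def power_mult_distrib power_mult)
qed

section \<open>Entries of the Weyl operators\<close>

lemma weyl_carrier [simp]: "weyl d u \<in> carrier_mat d d"
  by (auto simp: weyl_def shift_mat_def clock_mat_def intro!: mult_carrier_mat pow_carrier_mat)

lemma shift_mat_pow_index:
  assumes "i < d" "j < d"
  shows "(shift_mat d ^\<^sub>m q) $$ (i, j) = (if i = (j + q) mod d then 1 else 0)"
  using assms
proof (induction q arbitrary: j)
  case 0
  then show ?case by (simp add: shift_mat_def)
next
  case (Suc q)
  have c: "shift_mat d ^\<^sub>m q \<in> carrier_mat d d" "shift_mat d \<in> carrier_mat d d"
    by (auto simp: shift_mat_def intro!: pow_carrier_mat)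
  have "(shift_mat d ^\<^sub>m Suc q) $$ (i, j) = (\<Sum>k<d. (shift_mat d ^\<^sub>m q) $$ (i, k) * shift_mat d $$ (k, j))"
    using c Suc.prems by (simp add: scalar_prod_def atLeast0LessThan)
  also have "\<dots> = (\<Sum>k<d. if k = (j + 1) mod d then (if i = (k + q) mod d then 1 else 0) else 0)"
    using Suc by (intro sum.cong refl) (auto simp: shift_mat_def)
  also have "\<dots> = (if i = ((j + 1) mod d + q) mod d then 1 else 0)"
    using Suc.prems by simp
  also have "((j + 1) mod d + q) mod d = (j + Suc q) mod d"
    by (simp add: mod_add_left_eq)
  finally show ?case .
qed

lemma clock_mat_pow_index:
  assumes "i < d" "j < d"
  shows "(clock_mat d ^\<^sub>m r) $$ (i, j) = (if i = j then zeta d ^ (r * j) else 0)"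
  using assms
proof (induction r arbitrary: j)
  case 0
  then show ?case by (simp add: clock_mat_def)
next
  case (Suc r)
  have c: "clock_mat d ^\<^sub>m r \<in> carrier_mat d d" "clock_mat d \<in> carrier_mat d d"
    by (auto simp: clock_mat_def intro!: pow_carrier_mat)
  have "(clock_mat d ^\<^sub>m Suc r) $$ (i, j) = (\<Sum>k<d. (clock_mat d ^\<^sub>m r) $$ (i, k) * clock_mat d $$ (k, j))"
    using c Suc.prems by (simp add: scalar_prod_def atLeast0LessThan)
  also have "\<dots> = (\<Sum>k<d. if k = j then (if i = k then zeta d ^ (r * k) * zeta d ^ k else 0) else 0)"
    using Suc by (intro sum.cong refl) (auto simp: clock_mat_def zeta_def)
  also have "\<dots> = (if i = j then zeta d ^ (Suc r * j) else 0)"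
    using Suc.prems by (simp add: power_add mult.commute)
  finally show ?case .
qed

lemma weyl_index:
  assumes "i < d" "j < d"
  shows "weyl d u $$ (i, j) = (if i = (j + fst u) mod d then zeta d ^ (snd u * j) else 0)"
proof -
  have c: "shift_mat d ^\<^sub>m fst u \<in> carrier_mat d d" "clock_mat d ^\<^sub>m snd u \<in> carrier_mat d d"
    by (auto simp: shift_mat_def clock_mat_def intro!: pow_carrier_mat)
  have "weyl d u $$ (i, j) = (\<Sum>k<d. (shift_mat d ^\<^sub>m fst u) $$ (i, k) * (clock_mat d ^\<^sub>m snd u) $$ (k, j))"
    using carrier_matD[OF c(1)] carrier_matD[OF c(2)] assms
    by (simp add: weyl_def scalar_prod_def atLeast0LessThan)
  also have "\<dots> = (\<Sum>k<d. if k = j then (if i = (k + fst u) mod d then zeta d ^ (snd u * k) else 0) else 0)"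
    using assms by (intro sum.cong refl) (auto simp: shift_mat_pow_index clock_mat_pow_index)
  finally show ?thesis using assms by simp
qed

section \<open>Dense network coding\<close>

lemma max_entangled_carrier [simp]: "max_entangled d \<in> carrier_vec (d * d)"
  by (simp add: max_entangled_def)

lemma max_entangled_dim [simp]: "dim_vec (max_entangled d) = d * d"
  by (simp add: max_entangled_def)

lemma max_entangled_index:
  "j < d \<Longrightarrow> l < d \<Longrightarrow> max_entangled d $ (j * d + l) = (if j = l then 1 / of_real (sqrt (real d)) else 0)"
  by (simp add: max_entangled_def pair_index_less)

lemma bell_vec_carrier [simp]: "bell_vec d u \<in> carrier_vec (d * d)"
  using carrier_matD(1)[OF weyl_carrier[of d u]]
  by (auto simp: bell_vec_def kron_def intro!: carrier_vecI)

lemma bell_vec_dim [simp]: "dim_vec (bell_vec d u) = d * d"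
  using bell_vec_carrier by (rule carrier_vecD)

text \<open>A Bell vector is the vectorised Weyl operator, scaled by the square root of the
  dimension. Inner products of Bell vectors therefore become Hilbert-Schmidt products of Weyl
  operators.\<close>

lemma bell_vec_index:
  assumes "i < d" "k < d"
  shows "bell_vec d u $ (i * d + k) = weyl d u $$ (i, k) / of_real (sqrt (real d))"
proof -
  let ?W = "weyl d u"
  note W = carrier_matD[OF weyl_carrier[of d u]]
  have "bell_vec d u $ (i * d + k) = (\<Sum>x<d * d. kron ?W (1\<^sub>m d) $$ (i * d + k, x) * max_entangled d $ x)"
    using assms W
    by (simp add: bell_vec_def kron_def scalar_prod_def atLeast0LessThan pair_index_less max_entangled_def)
  also have "\<dots> = (\<Sum>j<d. \<Sum>l<d. if l = k then if j = l then ?W $$ (i, j) / of_real (sqrt (real d)) else 0 else 0)"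
    unfolding sum_pair_index using assms W
    by (intro sum.cong refl) (auto simp: kron_def pair_index_less max_entangled_index)
  finally show ?thesis using assms by simp
qed

lemma sqrt_square_complex: "of_real (sqrt (real d)) * of_real (sqrt (real d)) = (of_nat d :: complex)"
  by (simp flip: of_real_mult)

lemma bell_vec_mult_cnj:
  assumes "i < d" "k < d" "j < d" "l < d"
  shows "bell_vec d u $ (i * d + k) * cnj (bell_vec d v $ (j * d + l)) =
    weyl d u $$ (i, k) * cnj (weyl d v $$ (j, l)) / of_nat d"
  using assms by (simp add: bell_vec_index flip: sqrt_square_complex)

text \<open>Column \<open>k\<close> of a Weyl operator has its only nonzero entry in row
  \<open>k\<close> plus the shift, so different shifts never overlap; for equal shifts the clock
  parts are separated by orthogonality of characters.\<close>

lemma bell_vec_inner: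
  assumes "d > 0" "w \<in> Zd2 d" "w' \<in> Zd2 d"
  shows "(\<Sum>i<d. \<Sum>k<d. bell_vec d w $ (i * d + k) * cnj (bell_vec d w' $ (i * d + k))) = (if w = w' then 1 else 0)"
proof -
  have w: "fst w < d" "snd w < d" "fst w' < d" "snd w' < d"
    using assms by (auto simp: Zd2_def)
  have "(\<Sum>i<d. \<Sum>k<d. bell_vec d w $ (i * d + k) * cnj (bell_vec d w' $ (i * d + k))) =
    (\<Sum>k<d. \<Sum>i<d. weyl d w $$ (i, k) * cnj (weyl d w' $$ (i, k)) / of_nat d)"
    by (subst sum.swap, intro sum.cong refl) (simp add: bell_vec_mult_cnj)
  also have "\<dots> = (\<Sum>k<d. \<Sum>i<d. if i = (k + fst w) mod d then if fst w = fst w' then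
      zeta d ^ (snd w * k) * cnj (zeta d ^ (snd w' * k)) / of_nat d else 0 else 0)"
    using w by (intro sum.cong refl) (auto simp: weyl_index mod_add_eq_iff)
  also have "\<dots> = (\<Sum>k<d. if fst w = fst w' then
      zeta d ^ (snd w * k) * cnj (zeta d ^ (snd w' * k)) / of_nat d else 0)"
    using assms(1) by (intro sum.cong refl) (subst sum.delta, auto)
  also have "\<dots> = (if fst w = fst w' then
      (\<Sum>k<d. zeta d ^ (snd w * k) * cnj (zeta d ^ (snd w' * k))) / of_nat d else 0)"
    by (simp add: sum_divide_distrib)
  also have "\<dots> = (if w = w' then 1 else 0)"
    using assms(1) unfolding zeta_orthogonal[OF assms(1) w(2,4)] by (simp add: prod_eq_iff)
  finally show ?thesis .
qed

lemma bell_vec_orthonormal: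
  assumes "d > 0" "w \<in> Zd2 d" "w' \<in> Zd2 d"
  shows "bell_vec d w \<bullet>c bell_vec d w' = (if w = w' then 1 else 0)"
proof -
  have "bell_vec d w \<bullet>c bell_vec d w' = (\<Sum>x<d * d. bell_vec d w $ x * cnj (bell_vec d w' $ x))"
    by (simp add: scalar_prod_def atLeast0LessThan)
  then show ?thesis using bell_vec_inner[OF assms] by (simp add: sum_pair_index)
qed

lemma sum_if_const: "(\<Sum>r\<in>A. if c then f r else 0) = (if c then \<Sum>r\<in>A. f r else 0)"
  by simp

text \<open>Here the sum runs over the labels. The clock label \<open>r\<close> forces
  \<open>k = l\<close>, after which exactly one shift \<open>q\<close> carries \<open>k\<close> to
  \<open>i\<close>.\<close>

lemma bell_vec_complete:
  assumes "d > 0" "i < d" "k < d" "j < d" "l < d"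
  shows "(\<Sum>w\<in>Zd2 d. bell_vec d w $ (i * d + k) * cnj (bell_vec d w $ (j * d + l))) =
    (if i = j \<and> k = l then 1 else 0)"
proof -
  have "(\<Sum>w\<in>Zd2 d. bell_vec d w $ (i * d + k) * cnj (bell_vec d w $ (j * d + l))) =
    (\<Sum>q<d. \<Sum>r<d. weyl d (q, r) $$ (i, k) * cnj (weyl d (q, r) $$ (j, l)) / of_nat d)"
    unfolding Zd2_def atLeast0LessThan sum_Times using assms
    by (intro sum.cong refl) (simp add: bell_vec_mult_cnj)
  also have "\<dots> = (\<Sum>q<d. \<Sum>r<d. if i = (q + k) mod d \<and> j = (q + l) mod d
      then zeta d ^ (k * r) * cnj (zeta d ^ (l * r)) / of_nat d else 0)"
    using assms by (intro sum.cong refl) (simp add: weyl_index add.commute mult.commute)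
  also have "\<dots> = (\<Sum>q<d. if i = (q + k) mod d \<and> j = (q + l) mod d
      then (\<Sum>r<d. zeta d ^ (k * r) * cnj (zeta d ^ (l * r))) / of_nat d else 0)"
    unfolding sum_if_const sum_divide_distrib ..
  also have "\<dots> = (\<Sum>q<d. if k = l \<and> i = (q + k) mod d \<and> j = (q + k) mod d then 1 else 0)"
    unfolding zeta_orthogonal[OF assms(1,3,5)] using assms(1) by (intro sum.cong refl) auto
  also have "\<dots> = (\<Sum>m<d. if k = l \<and> i = m \<and> j = m then 1 else 0)"
    by (rule sum.reindex_bij_betw[OF bij_betw_mod_add[OF assms(1), of k]])
  also have "\<dots> = (\<Sum>m<d. if m = i then if i = j \<and> k = l then 1 else 0 else 0)"
    by (intro sum.cong refl) auto
  finally show ?thesis using assms by simp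
qed

lemma dnc_measurement_povm:
  assumes "d > 0"
  shows "povm (Zd2 d) (d * d) (dnc_measurement d)"
proof -
  have "mat (d * d) (d * d) (\<lambda>ij. \<Sum>z\<in>Zd2 d. dnc_measurement d z $$ ij) = 1\<^sub>m (d * d)"
  proof (rule eq_matI)
    fix x y assume "x < dim_row (1\<^sub>m (d * d) :: complex mat)" "y < dim_col (1\<^sub>m (d * d) :: complex mat)"
    then have lt: "x < d * d" "y < d * d" by auto
    have m: "x div d < d" "x mod d < d" "y div d < d" "y mod d < d"
      using lt assms by (auto simp: less_mult_imp_div_less)
    have "(\<Sum>z\<in>Zd2 d. dnc_measurement d z $$ (x, y)) = (\<Sum>w\<in>Zd2 d. bell_vec d w $ x * cnj (bell_vec d w $ y))"
      using lt by (simp add: dnc_measurement_def ketbra_def)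
    also have "\<dots> = (if x div d = y div d \<and> x mod d = y mod d then 1 else 0)"
      using bell_vec_complete[OF assms m] by simp
    also have "x div d = y div d \<and> x mod d = y mod d \<longleftrightarrow> x = y"
      by (metis div_mult_mod_eq)
    finally show "mat (d * d) (d * d) (\<lambda>ij. \<Sum>z\<in>Zd2 d. dnc_measurement d z $$ ij) $$ (x, y) = 1\<^sub>m (d * d) $$ (x, y)"
      using lt by simp
  qed auto
  then show ?thesis
    by (simp add: povm_def dnc_measurement_def psd_ketbra)
qed

lemma dnc_state_density:
  assumes "d > 0"
  shows "density_operator (d * d) (dnc_state d)"
proof -
  have "ketbra (max_entangled d) \<in> carrier_mat (d * d) (d * d)"
    by (simp add: ketbra_def max_entangled_def)
  then have "mat_trace (dnc_state d) = (\<Sum>x<d * d. ketbra (max_entangled d) $$ (x, x))"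
    unfolding dnc_state_def by (rule mat_trace_carrier)
  also have "\<dots> = (\<Sum>x<d * d. max_entangled d $ x * cnj (max_entangled d $ x))"
    by (simp add: ketbra_def)
  also have "\<dots> = (\<Sum>j<d. \<Sum>l<d. if l = j then 1 / of_nat d else 0)"
    unfolding sum_pair_index
    by (intro sum.cong refl) (auto simp: max_entangled_index simp flip: sqrt_square_complex)
  also have "\<dots> = 1" using assms by simp
  finally show ?thesis
    by (simp add: density_operator_def dnc_state_def psd_ketbra)
qed

lemma weyl_isometry:
  assumes "k < d" "l < d"
  shows "(\<Sum>i<d. weyl d u $$ (i, k) * cnj (weyl d u $$ (i, l))) = (if k = l then 1 else 0)"
proof -
  have d: "d > 0" using assms by simp
  have "(\<Sum>i<d. weyl d u $$ (i, k) * cnj (weyl d u $$ (i, l))) =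
    (\<Sum>i<d. if i = (k + fst u) mod d then if k = l then zeta d ^ (snd u * k) * cnj (zeta d ^ (snd u * k)) else 0 else 0)"
    using assms by (intro sum.cong refl) (auto simp: weyl_index mod_add_eq_iff)
  also have "\<dots> = (if k = l then 1 else 0)"
    unfolding zeta_cnj using d by (subst sum.delta) auto
  finally show ?thesis .
qed

text \<open>Columns of the transpose are rows of the Weyl operator, so this is the other half of its
  unitarity.\<close>

lemma weyl_transpose_isometry:
  assumes "k < d" "l < d"
  shows "(\<Sum>i<d. (weyl d u)\<^sup>T $$ (i, k) * cnj ((weyl d u)\<^sup>T $$ (i, l))) = (if k = l then 1 else 0)"
proof -
  have d: "d > 0" using assms by simp
  have "(\<Sum>i<d. (weyl d u)\<^sup>T $$ (i, k) * cnj ((weyl d u)\<^sup>T $$ (i, l))) =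
    (\<Sum>i<d. weyl d u $$ (k, i) * cnj (weyl d u $$ (l, i)))"
    using assms carrier_matD[OF weyl_carrier[of d u]] by (intro sum.cong refl) simp
  also have "\<dots> = (\<Sum>i<d. if k = (i + fst u) mod d \<and> l = (i + fst u) mod d then
      zeta d ^ (snd u * i) * cnj (zeta d ^ (snd u * i)) else 0)"
    using assms by (intro sum.cong refl) (simp add: weyl_index)
  also have "\<dots> = (\<Sum>i<d. if k = (i + fst u) mod d \<and> l = (i + fst u) mod d then 1 else 0)"
    unfolding zeta_cnj ..
  also have "\<dots> = (\<Sum>m<d. if k = m \<and> l = m then 1 else 0)"
    by (rule sum.reindex_bij_betw[OF bij_betw_mod_add[OF d, of "fst u"]])
  also have "\<dots> = (\<Sum>m<d. if m = k then if k = l then 1 else 0 else 0)"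
    by (intro sum.cong refl) auto
  finally show ?thesis using assms by simp
qed

lemma dnc_strategy:
  assumes "d > 0"
  shows "assisted_strategy (Zd2 d) (Zd2 d) (Zd2 d) d d d d
    (dnc_state d) (dnc_sender1 d) (dnc_sender2 d) (dnc_measurement d)"
  unfolding assisted_strategy_def dnc_sender1_def dnc_sender2_def
  by (intro conjI ballI dnc_state_density dnc_measurement_povm conjugation_map_channel
      weyl_isometry weyl_transpose_isometry assms) (simp_all add: transpose_carrier_mat)

text \<open>The senders' operations turn \<open>\<Phi>\<close> into \<open>(W\<^sub>u W\<^sub>v \<otimes> I) \<Phi>\<close>, which is the Bell vector of the sum up
  to the phase from commuting a clock past a shift.\<close>

lemma dnc_output_vec:
  assumes "i < d" "k < d"
  shows "(\<Sum>j<d. \<Sum>l<d. max_entangled d $ pair_index d (j, l) * (weyl d u $$ (i, j) * (weyl d v)\<^sup>T $$ (k, l)))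
    = zeta d ^ (snd u * fst v) * bell_vec d (oplus2 d u v) $ (i * d + k)"
proof -
  have d: "d > 0" using assms by simp
  let ?c = "1 / of_real (sqrt (real d)) :: complex" and ?m = "(k + fst v) mod d"
  have m: "?m < d" using d by simp
  \<comment> \<open>The state forces \<open>l = j\<close>, and the transpose turns the entry at
    \<open>(k, j)\<close> into that of \<open>weyl d v\<close> at \<open>(j, k)\<close>: what
    remains is an entry of the matrix product.\<close>
  have "(\<Sum>j<d. \<Sum>l<d. max_entangled d $ pair_index d (j, l) * (weyl d u $$ (i, j) * (weyl d v)\<^sup>T $$ (k, l))) =
    (\<Sum>j<d. \<Sum>l<d. if l = j then ?c * (weyl d u $$ (i, j) * weyl d v $$ (j, k)) else 0)"
    using assms carrier_matD[OF weyl_carrier[of d v]]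
    by (intro sum.cong refl) (auto simp: pair_index_def max_entangled_index)
  also have "\<dots> = (\<Sum>j<d. if j = ?m then ?c * (weyl d u $$ (i, j) * zeta d ^ (snd v * k)) else 0)"
    using assms by (intro sum.cong refl) (simp add: weyl_index)
  also have "\<dots> = ?c * (weyl d u $$ (i, ?m) * zeta d ^ (snd v * k))"
    using m by simp
  also have "weyl d u $$ (i, ?m) = (if i = (k + fst (oplus2 d u v)) mod d then zeta d ^ (snd u * (k + fst v)) else 0)"
  proof -
    have "(?m + fst u) mod d = (k + fst (oplus2 d u v)) mod d"
      by (simp add: oplus2_def mod_add_left_eq mod_add_right_eq ac_simps)
    moreover have "zeta d ^ (snd u * ?m) = zeta d ^ (snd u * (k + fst v))"
      by (metis d zeta_mod mod_mult_right_eq)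
    ultimately show ?thesis using assms(1) m by (simp add: weyl_index)
  qed
  \<comment> \<open>In the exponent \<open>snd u * (k + fst v)\<close> the part
    \<open>snd u * fst v\<close> does not depend on \<open>k\<close>; it leaves as a global phase,
    and the rest joins \<open>snd v * k\<close>.\<close>
  also have "?c * ((if i = (k + fst (oplus2 d u v)) mod d then zeta d ^ (snd u * (k + fst v)) else 0) * zeta d ^ (snd v * k))
     = zeta d ^ (snd u * fst v) * (weyl d (oplus2 d u v) $$ (i, k) / of_real (sqrt (real d)))"
  proof -
    have "zeta d ^ (snd (oplus2 d u v) * k) = zeta d ^ ((snd u + snd v) * k)"
      unfolding oplus2_def snd_conv by (metis d zeta_mod mod_mult_left_eq)
    then show ?thesis
      using assms by (simp add: weyl_index power_add distrib_left distrib_right)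
  qed
  finally show ?thesis by (simp add: bell_vec_index[OF assms])
qed

text \<open>The phase cancels in the density operator, so the output state is the projector onto the
  Bell vector of the sum. Its trace against the same projector is the square of the squared norm,
  hence 1.\<close>

lemma dnc_outcome:
  assumes "d > 0" "u \<in> Zd2 d" "v \<in> Zd2 d"
  shows "outcome_prob d d d d (dnc_state d) (dnc_sender1 d) (dnc_sender2 d) (dnc_measurement d)
    (oplus2 d u v) u v = 1"
proof -
  let ?w = "oplus2 d u v" and ?S = "{..<d} \<times> {..<d}"
  let ?c = "zeta d ^ (snd u * fst v)"
  let ?b = "\<lambda>p. bell_vec d ?w $ pair_index d p"
  have w: "?w \<in> Zd2 d" using assms(1) by (simp add: oplus2_def Zd2_def)
  have norm: "(\<Sum>p\<in>?S. ?b p * cnj (?b p)) = 1"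
    using bell_vec_inner[OF assms(1) w w] by (simp add: sum_Times pair_index_def)
  have T: "entry2 d (tensor_map d d d d (dnc_sender1 d u) (dnc_sender2 d v) (dnc_state d)) p q =
    ?b p * cnj (?b q)" if pq: "p \<in> ?S" "q \<in> ?S" for p q
  proof -
    obtain i i' j j' where eqs: "p = (i, i')" "q = (j, j')"
      and lt: "i < d" "i' < d" "j < d" "j' < d" using pq by auto
    have tr: "(weyl d v)\<^sup>T \<in> carrier_mat d d" by (simp add: transpose_carrier_mat)
    have "entry2 d (tensor_map d d d d (dnc_sender1 d u) (dnc_sender2 d v) (dnc_state d)) p q =
      (?c * ?b p) * cnj (?c * ?b q)"
      unfolding eqs dnc_sender1_def dnc_sender2_def dnc_state_def
        tensor_map_conjugation_ketbra[OF weyl_carrier tr max_entangled_carrier lt]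
        dnc_output_vec[OF lt(1,2)] dnc_output_vec[OF lt(3,4)]
      by (simp add: pair_index_def)
    also have "\<dots> = (?c * cnj ?c) * (?b p * cnj (?b q))" by (simp only: complex_cnj_mult mult_ac)
    finally show ?thesis by (simp only: zeta_cnj mult_1)
  qed
  have "outcome_prob d d d d (dnc_state d) (dnc_sender1 d) (dnc_sender2 d) (dnc_measurement d) ?w u v =
    (\<Sum>p\<in>?S. \<Sum>q\<in>?S. entry2 d (dnc_measurement d ?w) p q *
      entry2 d (tensor_map d d d d (dnc_sender1 d u) (dnc_sender2 d v) (dnc_state d)) q p)"
    by (rule outcome_prob_pairs[OF dnc_strategy[OF assms(1)] w])
  also have "\<dots> = (\<Sum>p\<in>?S. \<Sum>q\<in>?S. (?b p * cnj (?b p)) * (?b q * cnj (?b q)))"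
    by (intro sum.cong refl) (simp only: T dnc_measurement_def entry2_ketbra[OF bell_vec_carrier] mult_ac)
  also have "\<dots> = (\<Sum>p\<in>?S. ?b p * cnj (?b p)) * (\<Sum>q\<in>?S. ?b q * cnj (?b q))"
    by (rule sum_product[symmetric])
  finally show ?thesis unfolding norm by simp
qed

text \<open>A supremum over the empty set of reals carries no information, so the upper bound on it
  requires a member. The witness is a constant strategy: a fixed pure state, identity channels, and
  a measurement that always answers \<open>z0\<close>.\<close>

lemma QE_nonempty:
  assumes "d1 > 0" "d2 > 0" "finite Zs" "z0 \<in> Zs"
  shows "QE Xs Ys Zs d1 d2 \<noteq> {}"
proof -
  define e :: "complex vec" where "e = unit_vec (d1 * d2) 0"
  have e: "e \<in> carrier_vec (d1 * d2)" by (simp add: e_def)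
  have pos: "0 < d1 * d2" using assms by simp
  have "mat_trace (ketbra e) = 1"
  proof -
    have "mat_trace (ketbra e) = (\<Sum>i<d1 * d2. if i = 0 then 1 else 0)"
      unfolding mat_trace_def by (rule sum.cong) (auto simp: ketbra_def e_def unit_vec_def)
    then show ?thesis using pos by simp
  qed
  then have rho: "density_operator (d1 * d2) (ketbra e)"
    using psd_ketbra[OF e] by (simp add: density_operator_def)
  have id: "quantum_channel m m (conjugation_map (1\<^sub>m m))" for m
  proof (rule conjugation_map_channel)
    fix k l assume kl: "k < m" "l < m"
    have "(\<Sum>i<m. 1\<^sub>m m $$ (i, k) * cnj (1\<^sub>m m $$ (i, l))) = (\<Sum>i<m. if i = k then if k = l then 1 else 0 else 0)"
      using kl by (intro sum.cong) auto
    then show "(\<Sum>i<m. 1\<^sub>m m $$ (i, k) * cnj (1\<^sub>m m $$ (i, l))) = (if k = l then 1 else 0)"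
      using kl by simp
  qed simp
  define P where "P = (\<lambda>z. if z = z0 then 1\<^sub>m (d1 * d2) else 0\<^sub>m (d1 * d2) (d1 * d2) :: complex mat)"
  have "psd (d1 * d2) (P z)" for z
  proof -
    have "psd (d1 * d2) (1\<^sub>m (d1 * d2))"
      by (auto simp: psd_def)
    moreover have "psd (d1 * d2) (0\<^sub>m (d1 * d2) (d1 * d2))"
      by (auto simp: psd_iff_psd_on intro!: psd_onI sum_nonneg)
    ultimately show ?thesis by (simp add: P_def)
  qed
  moreover have "mat (d1 * d2) (d1 * d2) (\<lambda>ij. \<Sum>z\<in>Zs. P z $$ ij) = 1\<^sub>m (d1 * d2)"
  proof (rule eq_matI)
    fix i j assume ij: "i < dim_row (1\<^sub>m (d1 * d2) :: complex mat)" "j < dim_col (1\<^sub>m (d1 * d2) :: complex mat)"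
    then have "(\<Sum>z\<in>Zs. P z $$ (i, j)) = (\<Sum>z\<in>Zs. if z = z0 then 1\<^sub>m (d1 * d2) $$ (i, j) else 0)"
      by (intro sum.cong) (auto simp: P_def)
    then show "mat (d1 * d2) (d1 * d2) (\<lambda>ij. \<Sum>z\<in>Zs. P z $$ ij) $$ (i, j) = 1\<^sub>m (d1 * d2) $$ (i, j)"
      using ij assms(3,4) by simp
  qed auto
  ultimately have "povm Zs (d1 * d2) P" by (simp add: povm_def)
  then have "assisted_strategy Xs Ys Zs d1 d2 d1 d2 (ketbra e)
    (\<lambda>_. conjugation_map (1\<^sub>m d1)) (\<lambda>_. conjugation_map (1\<^sub>m d2)) P"
    using rho id by (simp add: assisted_strategy_def)
  from strategy_in_QE[OF this] show ?thesis by blast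
qed

lemma finite_Zd2 [simp]: "finite (Zd2 d)"
  by (simp add: Zd2_def)

lemma card_Zd2 [simp]: "card (Zd2 d) = d\<^sup>2"
  by (simp add: Zd2_def card_cartesian_product power2_eq_square)

lemma oplus2_in_Zd2: "d > 0 \<Longrightarrow> oplus2 d u v \<in> Zd2 d"
  by (simp add: oplus2_def Zd2_def)

lemma inj_on_oplus2:
  "inj_on (\<lambda>u. oplus2 d u v) (Zd2 d)" "inj_on (oplus2 d u) (Zd2 d)"
  by (auto simp: inj_on_def oplus2_def Zd2_def mod_add_eq_iff)

text \<open>The table of \<open>oplus2\<close> is a Latin square: fixing either argument leaves an
  injection into the outcomes. Each of the \<open>d^2\<close> columns then contributes at most
  \<open>d1^2\<close> and each row at most \<open>d2^2\<close>, to be divided by the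
  \<open>d^4\<close> input pairs. The bound by 1 matters for the perfect protocol, where it makes
  the attained value a maximum.\<close>

lemma success_prob_le:
  assumes d: "d > 0" and Q: "Q \<in> QE (Zd2 d) (Zd2 d) (Zd2 d) d1 d2"
  shows "success_prob (Zd2 d) (Zd2 d) (oplus2 d) Q \<le> (real d1)\<^sup>2 / (real d)\<^sup>2"
    and "success_prob (Zd2 d) (Zd2 d) (oplus2 d) Q \<le> (real d2)\<^sup>2 / (real d)\<^sup>2"
    and "success_prob (Zd2 d) (Zd2 d) (oplus2 d) Q \<le> 1"
proof -
  let ?S = "Zd2 d" and ?t = "\<Sum>u\<in>Zd2 d. \<Sum>v\<in>Zd2 d. Q (oplus2 d u v) u v"
  have sp: "success_prob ?S ?S (oplus2 d) Q = ?t / ((real d)\<^sup>2 * (real d)\<^sup>2)"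
    by (simp add: success_prob_def)
  have bound: "success_prob ?S ?S (oplus2 d) Q \<le> c / (real d)\<^sup>2" if "?t \<le> (real d)\<^sup>2 * c" for c
  proof -
    have "?t / ((real d)\<^sup>2 * (real d)\<^sup>2) \<le> ((real d)\<^sup>2 * c) / ((real d)\<^sup>2 * (real d)\<^sup>2)"
      by (intro divide_right_mono that) simp
    then show ?thesis unfolding sp using d by (simp add: power2_eq_square)
  qed
  have row: "(\<Sum>v\<in>?S. Q (oplus2 d u v) u v) \<le> (real d2)\<^sup>2" if "u \<in> ?S" for u
    using QE_sum_right_le[OF Q, of u "oplus2 d u"] that inj_on_oplus2
    by (simp add: image_subset_iff oplus2_in_Zd2[OF d])
  have col: "(\<Sum>u\<in>?S. Q (oplus2 d u v) u v) \<le> (real d1)\<^sup>2" if "v \<in> ?S" for v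
    using QE_sum_left_le[OF Q, of v "\<lambda>u. oplus2 d u v"] that inj_on_oplus2
    by (simp add: image_subset_iff oplus2_in_Zd2[OF d])
  have "?t \<le> (\<Sum>u\<in>?S. (real d2)\<^sup>2)" by (intro sum_mono row)
  then show "success_prob ?S ?S (oplus2 d) Q \<le> (real d2)\<^sup>2 / (real d)\<^sup>2"
    by (intro bound) simp
  have "?t = (\<Sum>v\<in>?S. \<Sum>u\<in>?S. Q (oplus2 d u v) u v)" by (rule sum.swap)
  also have "\<dots> \<le> (\<Sum>v\<in>?S. (real d1)\<^sup>2)" by (intro sum_mono col)
  finally show "success_prob ?S ?S (oplus2 d) Q \<le> (real d1)\<^sup>2 / (real d)\<^sup>2"
    by (intro bound) simp
  have "?t \<le> (\<Sum>u\<in>?S. \<Sum>v\<in>?S. 1)"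
    using QE_le_1[OF Q] oplus2_in_Zd2[OF d] by (intro sum_mono) auto
  then have "success_prob ?S ?S (oplus2 d) Q \<le> (real d)\<^sup>2 / (real d)\<^sup>2"
    by (intro bound) simp
  then show "success_prob ?S ?S (oplus2 d) Q \<le> 1" using d by simp
qed

theorem theorem1:
  fixes n d :: nat
  assumes "n > 0" and "d = 2 ^ n"
  shows
    "(assisted_strategy (Zd2 d) (Zd2 d) (Zd2 d) d d d d
        (dnc_state d) (dnc_sender1 d) (dnc_sender2 d) (dnc_measurement d) \<and>
      (\<forall>w\<in>Zd2 d. \<forall>w'\<in>Zd2 d. bell_vec d w \<bullet>c bell_vec d w' = (if w = w' then 1 else 0)) \<and>
      (\<forall>u\<in>Zd2 d. \<forall>v\<in>Zd2 d.
        outcome_prob d d d d (dnc_state d) (dnc_sender1 d) (dnc_sender2 d) (dnc_measurement d)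
          (oplus2 d u v) u v = 1)) \<and>
     max_success_prob (Zd2 d) (Zd2 d) (oplus2 d) (QE (Zd2 d) (Zd2 d) (Zd2 d) d d) = 1 \<and>
     (\<forall>n1 n2 :: nat. min n1 n2 < n \<longrightarrow>
        max_success_prob (Zd2 d) (Zd2 d) (oplus2 d)
          (QE (Zd2 d) (Zd2 d) (Zd2 d) (2 ^ n1) (2 ^ n2)) < 1)"
proof (intro conjI ballI allI impI)
  have d: "d > 0" using assms by simp
  show strategy: "assisted_strategy (Zd2 d) (Zd2 d) (Zd2 d) d d d d
      (dnc_state d) (dnc_sender1 d) (dnc_sender2 d) (dnc_measurement d)"
    by (rule dnc_strategy[OF d])
  show "bell_vec d w \<bullet>c bell_vec d w' = (if w = w' then 1 else 0)" if "w \<in> Zd2 d" "w' \<in> Zd2 d" for w w'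
    by (rule bell_vec_orthonormal[OF d that])
  show outcome: "outcome_prob d d d d (dnc_state d) (dnc_sender1 d) (dnc_sender2 d) (dnc_measurement d)
      (oplus2 d u v) u v = 1" if "u \<in> Zd2 d" "v \<in> Zd2 d" for u v
    by (rule dnc_outcome[OF d that])
  show "max_success_prob (Zd2 d) (Zd2 d) (oplus2 d) (QE (Zd2 d) (Zd2 d) (Zd2 d) d d) = 1"
  proof -
    let ?Q = "\<lambda>z x y. Re (outcome_prob d d d d (dnc_state d) (dnc_sender1 d) (dnc_sender2 d) (dnc_measurement d) z x y)"
    have "(\<Sum>x\<in>Zd2 d. \<Sum>y\<in>Zd2 d. ?Q (oplus2 d x y) x y) = (\<Sum>x\<in>Zd2 d. \<Sum>y\<in>Zd2 d. 1)"
      by (intro sum.cong refl) (simp add: outcome)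
    then have "success_prob (Zd2 d) (Zd2 d) (oplus2 d) ?Q = 1"
      using d by (simp add: success_prob_def)
    moreover have "?Q \<in> QE (Zd2 d) (Zd2 d) (Zd2 d) d d"
      by (rule strategy_in_QE[OF strategy])
    ultimately show ?thesis
      unfolding max_success_prob_def
      by (intro cSup_eq_maximum) (use success_prob_le(3)[OF d] in \<open>force+\<close>)
  qed
  fix n1 n2 :: nat
  assume min: "min n1 n2 < n"
  \<comment> \<open>A power of two below \<open>d\<close> is at most \<open>d / 2\<close>, and
    squaring gives 1/4. As this constant is the same for all strategies, it survives the passage to
    the supremum.\<close>
  have quarter: "(real (2 ^ m))\<^sup>2 / (real d)\<^sup>2 \<le> 1 / 4" if "m < n" for m
  proof -
    have "(2 :: real) ^ Suc m \<le> 2 ^ n" using that by (intro power_increasing) auto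
    then have "(2 ^ Suc m :: real)\<^sup>2 \<le> (2 ^ n)\<^sup>2" by (intro power_mono) auto
    then show ?thesis using assms by (simp add: field_simps power2_eq_square)
  qed
  have "success_prob (Zd2 d) (Zd2 d) (oplus2 d) Q \<le> 1 / 4"
    if "Q \<in> QE (Zd2 d) (Zd2 d) (Zd2 d) (2 ^ n1) (2 ^ n2)" for Q
  proof (cases "n1 < n")
    case True
    then show ?thesis by (intro order_trans[OF success_prob_le(1)[OF d that] quarter])
  next
    case False
    then have "n2 < n" using min by simp
    then show ?thesis by (intro order_trans[OF success_prob_le(2)[OF d that] quarter])
  qed
  moreover have "QE (Zd2 d) (Zd2 d) (Zd2 d) (2 ^ n1) (2 ^ n2) \<noteq> {}"
    using d by (intro QE_nonempty[of _ _ _ "(0, 0)"]) (auto simp: Zd2_def)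
  ultimately have "max_success_prob (Zd2 d) (Zd2 d) (oplus2 d)
      (QE (Zd2 d) (Zd2 d) (Zd2 d) (2 ^ n1) (2 ^ n2)) \<le> 1 / 4"
    unfolding max_success_prob_def by (rule cSUP_least[rotated])
  then show "max_success_prob (Zd2 d) (Zd2 d) (oplus2 d)
      (QE (Zd2 d) (Zd2 d) (Zd2 d) (2 ^ n1) (2 ^ n2)) < 1"
    by simp
qed

end
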